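(* For any $k\in\mathbb N$ and $x_1,\dots,x_k\in\mathfrak M_{0,\mathrm{sa}}$, \[\lim_{n\to\infty}\chi\big(e^{iF_n(x_1)}e^{iF_n(x_2)}\cdots e^{iF_n(x_k)}\big)=\varphi_\chi\big(w(x_1)w(x_2)\cdots w(x_k)\big).\]
   Context: $\mathcal I$ is the set of finite intervals of $\mathbb Z$. $(\mathfrak M,(M_I)_{I\in\mathcal I})$ is a quasi-local algebra: $\mathfrak M$ a unital $C^*$-algebra, $M_I$ $W^*$-subalgebras with $M_I\subseteq M_J$ for $I\subseteq J$, $\mathfrak M_0:=\bigcup_IM_I$ norm dense, all $M_I$ containing the unit $1$, and $M_I$ commuting with $M_J$ when $I\cap J=\varnothing$. (In the paper's standing setup there is also a flow $\alpha$ preserving each $M_I$ and commuting with $\gamma$, and each $M_I$ is an $\ell^\infty$-direct sum of finite-dimensional matrix algebras.) $\gamma:\mathbb Z\curvearrowright\mathfrak M$ is an action by $*$-automorphisms with $\gamma_j(M_I)=M_{I+j}$, $I+j=\{n+j:n\in I\}$. $\chi$ is a fixed $\gamma$-invariant state on $\mathfrak M$ that is multiplicative: $\chi(xy)=\chi(x)\chi(y)$ for $x\in M_I$, $y\in M_J$, $I\cap J=\varnothing$. $(I_n)_{n\ge1}$ is a fixed increasing sequence in $\mathcal I$ with $\bigcup_nI_n=\mathbb Z$. $\mathfrak M_{0,\mathrm{sa}}$ is the set of self-adjoint elements of $\mathfrak M_0$. For $x\in\mathfrak M$, $F_n(x):=|I_n|^{-1/2}\sum_{j\in I_n}(\gamma_j(x)-\chi(x)1)$.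 For $x,y\in\mathfrak M_{0,\mathrm{sa}}$ (the sums below are finite), $s_\chi(x,y)=\mathrm{Re}\sum_{k\in\mathbb Z}(\chi(x\gamma_k(y))-\chi(x)\chi(y))$, $\sigma_\chi(x,y)=-\mathrm{Im}\sum_{k\in\mathbb Z}(\chi(x\gamma_k(y))-\chi(x)\chi(y))$. $\mathfrak W_\chi$ is the Weyl CCR $C^*$-algebra of the (possibly degenerate) symplectic space $(\mathfrak M_{0,\mathrm{sa}},\sigma_\chi)$: the universal $C^*$-algebra generated by unitaries $w(x)$, $x\in\mathfrak M_{0,\mathrm{sa}}$, with $w(x)^*=w(-x)$ and $w(x)w(y)=e^{i\sigma_\chi(x,y)}w(x+y)$. Since $(x,y)\mapsto s_\chi(x,y)-i\sigma_\chi(x,y)$ is positive definite, there is a (quasi-free) state $\varphi_\chi$ on $\mathfrak W_\chi$ with $\varphi_\chi(w(x))=e^{-s_\chi(x,x)/2}$ for all $x$. *)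

theory Defs
  imports "HOL-Analysis.Analysis"
begin

text \<open>A unital complex C*-algebra, presented as a real Banach algebra with unit together
 with a central element ci with ci*ci = -1 (giving the complex structure; complex scalar
 multiplication is scaleC below), an involution adj (the C*-adjoint), and the C*-identity.\<close>

class cstar_algebra = banach + real_normed_algebra_1 +
  fixes adj :: "'a \<Rightarrow> 'a" and ci :: 'a
  assumes ci_central: "ci * x = x * ci"
    and ci_sq: "ci * ci = - 1"
    and norm_complex_scale: "norm (Re z *\<^sub>R x + Im z *\<^sub>R (ci * x)) = cmod z * norm x"
    and adj_adj: "adj (adj x) = x"
    and adj_add: "adj (x + y) = adj x + adj y"
    and adj_scaleR: "adj (r *\<^sub>R x) = r *\<^sub>R adj x"
    and adj_ci: "adj ci = - ci"
    and adj_mult: "adj (x * y) = adj y * adj x"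
    and cstar_identity: "norm (adj x * x) = (norm x)\<^sup>2"

definition scaleC :: "complex \<Rightarrow> 'a::cstar_algebra \<Rightarrow> 'a" where
  "scaleC z x = Re z *\<^sub>R x + Im z *\<^sub>R (ci * x)"

definition self_adjoint :: "'a::cstar_algebra \<Rightarrow> bool" where
  "self_adjoint x \<longleftrightarrow> adj x = x"

definition is_state :: "('a::cstar_algebra \<Rightarrow> complex) \<Rightarrow> bool" where
  "is_state \<phi> \<longleftrightarrow>
     (\<forall>x y. \<phi> (x + y) = \<phi> x + \<phi> y) \<and>
     (\<forall>z x. \<phi> (scaleC z x) = z * \<phi> x) \<and>
     (\<forall>x. Im (\<phi> (adj x * x)) = 0 \<and> Re (\<phi> (adj x * x)) \<ge> 0) \<and>
     \<phi> 1 = 1"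

definition is_star_automorphism :: "('a::cstar_algebra \<Rightarrow> 'a) \<Rightarrow> bool" where
  "is_star_automorphism f \<longleftrightarrow> bij f \<and>
     (\<forall>x y. f (x + y) = f x + f y) \<and> (\<forall>x y. f (x * y) = f x * f y) \<and>
     (\<forall>z x. f (scaleC z x) = scaleC z (f x)) \<and> (\<forall>x. f (adj x) = adj (f x)) \<and> f 1 = 1"

definition is_unitary :: "'a::cstar_algebra \<Rightarrow> bool" where
  "is_unitary u \<longleftrightarrow> adj u * u = 1 \<and> u * adj u = 1"

definition is_cstar_subalgebra :: "'a::cstar_algebra set \<Rightarrow> bool" where
  "is_cstar_subalgebra A \<longleftrightarrow> 1 \<in> A \<and> closed A \<and>
     (\<forall>x\<in>A. \<forall>y\<in>A. x + y \<in> A \<and> x * y \<in> A) \<and>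
     (\<forall>x\<in>A. \<forall>z. scaleC z x \<in> A) \<and> (\<forall>x\<in>A. adj x \<in> A)"

definition mat_opnorm :: "nat \<Rightarrow> (nat \<Rightarrow> nat \<Rightarrow> complex) \<Rightarrow> real" where
  "mat_opnorm n A = Sup ((\<lambda>v. sqrt (\<Sum>j<n. (cmod (\<Sum>k<n. A j k * v k))\<^sup>2)) `
                         {v. (\<Sum>k<n. (cmod (v k))\<^sup>2) \<le> 1})"

definition linf_mat :: "'i set \<Rightarrow> ('i \<Rightarrow> nat) \<Rightarrow> ('i \<Rightarrow> nat \<Rightarrow> nat \<Rightarrow> complex) set" where
  "linf_mat S d = {f. (\<forall>i j k. (i \<notin> S \<or> d i \<le> j \<or> d i \<le> k) \<longrightarrow> f i j k = 0) \<and>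
                      bdd_above ((\<lambda>i. mat_opnorm (d i) (f i)) ` S)}"

definition mat_sum_iso ::
  "'a::cstar_algebra set \<Rightarrow> 'i set \<Rightarrow> ('i \<Rightarrow> nat) \<Rightarrow> ('a \<Rightarrow> 'i \<Rightarrow> nat \<Rightarrow> nat \<Rightarrow> complex) \<Rightarrow> bool" where
  "mat_sum_iso A S d \<Phi> \<longleftrightarrow> (\<forall>i\<in>S. 1 \<le> d i) \<and> bij_betw \<Phi> A (linf_mat S d) \<and>
     (\<forall>x\<in>A. \<forall>y\<in>A. \<Phi> (x + y) = (\<lambda>i j k. \<Phi> x i j k + \<Phi> y i j k)) \<and>
     (\<forall>x\<in>A. \<forall>y\<in>A. \<Phi> (x * y) = (\<lambda>i j k. \<Sum>l<d i. \<Phi> x i j l * \<Phi> y i l k)) \<and>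
     (\<forall>x\<in>A. \<forall>z. \<Phi> (scaleC z x) = (\<lambda>i j k. z * \<Phi> x i j k)) \<and>
     (\<forall>x\<in>A. \<Phi> (adj x) = (\<lambda>i j k. cnj (\<Phi> x i k j))) \<and>
     \<Phi> 1 = (\<lambda>i j k. if i \<in> S \<and> j = k \<and> j < d i then 1 else 0)"

definition is_linf_matrix_sum :: "'i itself \<Rightarrow> 'a::cstar_algebra set \<Rightarrow> bool" where
  "is_linf_matrix_sum _ A \<longleftrightarrow> (\<exists>(S::'i set) d \<Phi>. mat_sum_iso A S d \<Phi>)"

definition fin_intervals :: "int set set" where
  "fin_intervals = {{a..b} | a b. a \<le> b}"

definition local_union :: "(int set \<Rightarrow> 'a set) \<Rightarrow> 'a set" where
  "local_union M = \<Union> (M ` fin_intervals)"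

definition local_sa :: "(int set \<Rightarrow> 'a::cstar_algebra set) \<Rightarrow> 'a set" where
  "local_sa M = {x \<in> local_union M. self_adjoint x}"

definition quasi_local :: "'i itself \<Rightarrow> (int set \<Rightarrow> 'a::cstar_algebra set) \<Rightarrow> bool" where
  "quasi_local T M \<longleftrightarrow>
     (\<forall>I\<in>fin_intervals. is_cstar_subalgebra (M I) \<and> is_linf_matrix_sum T (M I)) \<and>
     (\<forall>I\<in>fin_intervals. \<forall>J\<in>fin_intervals. I \<subseteq> J \<longrightarrow> M I \<subseteq> M J) \<and>
     closure (local_union M) = UNIV \<and>
     (\<forall>I\<in>fin_intervals. \<forall>J\<in>fin_intervals. I \<inter> J = {} \<longrightarrow>
        (\<forall>x\<in>M I. \<forall>y\<in>M J. x * y = y * x))"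

definition translation_action :: "(int set \<Rightarrow> 'a::cstar_algebra set) \<Rightarrow> (int \<Rightarrow> 'a \<Rightarrow> 'a) \<Rightarrow> bool" where
  "translation_action M \<gamma> \<longleftrightarrow> \<gamma> 0 = id \<and> (\<forall>j k. \<gamma> (j + k) = \<gamma> j \<circ> \<gamma> k) \<and>
     (\<forall>j. is_star_automorphism (\<gamma> j)) \<and>
     (\<forall>j. \<forall>I\<in>fin_intervals. \<gamma> j ` M I = M ((\<lambda>n. n + j) ` I))"

definition product_invariant_state ::
  "(int set \<Rightarrow> 'a::cstar_algebra set) \<Rightarrow> (int \<Rightarrow> 'a \<Rightarrow> 'a) \<Rightarrow> ('a \<Rightarrow> complex) \<Rightarrow> bool" where
  "product_invariant_state M \<gamma> chi \<longleftrightarrow> is_state chi \<and> (\<forall>j x. chi (\<gamma> j x) = chi x) \<and>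
     (\<forall>I\<in>fin_intervals. \<forall>J\<in>fin_intervals. I \<inter> J = {} \<longrightarrow>
        (\<forall>x\<in>M I. \<forall>y\<in>M J. chi (x * y) = chi x * chi y))"

definition fluct :: "(int \<Rightarrow> 'a::cstar_algebra \<Rightarrow> 'a) \<Rightarrow> ('a \<Rightarrow> complex) \<Rightarrow> int set \<Rightarrow> 'a \<Rightarrow> 'a" where
  "fluct \<gamma> chi I x = (1 / sqrt (real (card I))) *\<^sub>R (\<Sum>j\<in>I. \<gamma> j x - scaleC (chi x) 1)"

definition corr_sum :: "(int \<Rightarrow> 'a::cstar_algebra \<Rightarrow> 'a) \<Rightarrow> ('a \<Rightarrow> complex) \<Rightarrow> 'a \<Rightarrow> 'a \<Rightarrow> complex" where
  "corr_sum \<gamma> chi x y = infsum (\<lambda>k. chi (x * \<gamma> k y) - chi x * chi y) UNIV"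

definition s_chi :: "(int \<Rightarrow> 'a::cstar_algebra \<Rightarrow> 'a) \<Rightarrow> ('a \<Rightarrow> complex) \<Rightarrow> 'a \<Rightarrow> 'a \<Rightarrow> real" where
  "s_chi \<gamma> chi x y = Re (corr_sum \<gamma> chi x y)"

definition sigma_chi :: "(int \<Rightarrow> 'a::cstar_algebra \<Rightarrow> 'a) \<Rightarrow> ('a \<Rightarrow> complex) \<Rightarrow> 'a \<Rightarrow> 'a \<Rightarrow> real" where
  "sigma_chi \<gamma> chi x y = - Im (corr_sum \<gamma> chi x y)"

text \<open>A realisation of the Weyl CCR relations over (M0sa, sigma_chi) in a C*-algebra,
 with a state taking the quasi-free values exp(-s_chi(x,x)/2) on Weyl unitaries.\<close>
definition weyl_quasifree ::
  "(int set \<Rightarrow> 'a::cstar_algebra set) \<Rightarrow> (int \<Rightarrow> 'a \<Rightarrow> 'a) \<Rightarrow> ('a \<Rightarrow> complex) \<Rightarrow>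
   ('a \<Rightarrow> 'w::cstar_algebra) \<Rightarrow> ('w \<Rightarrow> complex) \<Rightarrow> bool" where
  "weyl_quasifree M \<gamma> chi w \<phi> \<longleftrightarrow> is_state \<phi> \<and>
     (\<forall>x\<in>local_sa M. is_unitary (w x) \<and> adj (w x) = w (- x) \<and>
        \<phi> (w x) = complex_of_real (exp (- s_chi \<gamma> chi x x / 2))) \<and>
     (\<forall>x\<in>local_sa M. \<forall>y\<in>local_sa M.
        w x * w y = scaleC (exp (\<i> * complex_of_real (sigma_chi \<gamma> chi x y))) (w (x + y)))"

end

theory Submission
  imports Defs
begin

text \<open>
  The proof is Stein's method in the form of a differential equation. Put
  \<open>f(t) = chi (exp (i F(x_1)) ... exp (i F(x_k)) exp (i t F(x)))\<close>. In
  \<open>f'(t) = i chi (E F(x))\<close> the last factor is a sum over sites \<open>j\<close>; removing the sites near \<open>j\<close>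
  from all exponents costs a first-order term plus an error of norm \<open>O(1/|I|)\<close>, because removed
  and retained parts commute up to \<open>O(1/|I|)\<close>. What remains is independent of the site \<open>j\<close>, so
  the zeroth-order term vanishes and the first-order term factorises. Summing over \<open>j\<close> gives
  \<open>f'(t) = - (c(x_1 + ... + x_k, x) + t c(x, x)) f(t) + O(|I|\<^sup>-\<^sup>1\<^sup>/\<^sup>2)\<close> uniformly in
  \<open>t\<close>, where \<open>c\<close> is the correlation sum. Hence appending \<open>x\<close> multiplies the limit by
  \<open>exp (- c(x_1 + ... + x_k, x) - c(x, x) / 2)\<close>, and the Weyl relations give the same recursion
  for the quasi-free state.
\<close>

section \<open>States and automorphisms of C*-algebras\<close>

lemma adj_0 [simp]: "adj (0::'a::cstar_algebra) = 0"
  using adj_add[of 0 "0::'a"] by simp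

lemma adj_1 [simp]: "adj (1::'a::cstar_algebra) = 1"
  by (metis adj_adj adj_mult mult_1_left mult_1_right)

lemma adj_minus [simp]: "adj (- x) = - adj (x::'a::cstar_algebra)"
  using adj_add[of x "- x"] by (simp add: eq_neg_iff_add_eq_0 add.commute)

lemma adj_diff: "adj (x - y) = adj x - adj (y::'a::cstar_algebra)"
  using adj_add[of x "- y"] by simp

lemma norm_adj [simp]: "norm (adj x) = norm (x::'a::cstar_algebra)"
proof -
  have le: "norm y \<le> norm (adj y)" for y :: 'a
  proof (cases "y = 0")
    case False
    have "norm y * norm y = norm (adj y * y)"
      by (simp add: cstar_identity power2_eq_square)
    also have "\<dots> \<le> norm (adj y) * norm y"
      by (rule norm_mult_ineq)
    finally show ?thesis using False by simp
  qed simp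
  show ?thesis using le[of x] le[of "adj x"] by (simp add: adj_adj)
qed

lemma bounded_linear_adj: "bounded_linear (adj :: 'a::cstar_algebra \<Rightarrow> 'a)"
  by (rule bounded_linear_intro[where K=1]) (simp_all add: adj_add adj_scaleR)

lemma adj_sum: "adj (sum f S) = (\<Sum>j\<in>S. adj (f j :: 'a::cstar_algebra))"
  by (induction S rule: infinite_finite_induct) (simp_all add: adj_add)

lemma adj_power: "adj (x ^ n) = adj (x::'a::cstar_algebra) ^ n"
  by (induction n) (simp_all add: adj_mult power_commutes)

lemma adj_exp: "adj (exp x) = exp (adj (x::'a::cstar_algebra))"
proof -
  have "adj (exp x) = (\<Sum>n. adj (x ^ n /\<^sub>R fact n))"
    unfolding exp_def by (rule bounded_linear.suminf[OF bounded_linear_adj summable_exp_generic])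
  then show ?thesis
    by (simp add: exp_def adj_scaleR adj_power)
qed

lemma norm_unitary:
  assumes "is_unitary (u::'a::cstar_algebra)"
  shows "norm u = 1"
proof -
  have "(norm u)\<^sup>2 = 1"
    using assms cstar_identity[of u] by (simp add: is_unitary_def)
  then show ?thesis
    by (simp add: power2_eq_1_iff) (metis norm_ge_zero neg_0_le_iff_le not_one_le_zero)
qed

lemma is_unitary_exp:
  assumes "adj x = - (x::'a::cstar_algebra)"
  shows "is_unitary (exp x)"
  using assms exp_minus_inverse[of x] exp_minus_inverse[of "- x"]
  by (simp add: is_unitary_def adj_exp)

lemma norm_exp_skew:
  assumes "adj x = - (x::'a::cstar_algebra)"
  shows "norm (exp x) = 1"
  using assms is_unitary_exp norm_unitary by blast

lemma norm_scaleC: "norm (scaleC z (x::'a::cstar_algebra)) = cmod z * norm x"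
  by (simp add: scaleC_def norm_complex_scale)

lemma scaleC_of_real: "scaleC (of_real r) (x::'a::cstar_algebra) = r *\<^sub>R x"
  by (simp add: scaleC_def)

lemma scaleC_ii: "scaleC \<i> (x::'a::cstar_algebra) = ci * x"
  by (simp add: scaleC_def)

lemma scaleC_0 [simp]: "scaleC 0 (x::'a::cstar_algebra) = 0"
  and scaleC_1 [simp]: "scaleC 1 (x::'a::cstar_algebra) = x"
  by (simp_all add: scaleC_def)

lemma norm_ci_mult [simp]: "norm (ci * x) = norm (x::'a::cstar_algebra)"
  using norm_scaleC[of \<i> x] by (simp add: scaleC_ii)

lemma ci_ci_mult [simp]: "ci * (ci * x) = - (x::'a::cstar_algebra)"
  using ci_sq by (metis mult.assoc mult_minus1)

lemma ci_left_commute: "x * (ci * y) = ci * (x * (y::'a::cstar_algebra))"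
  by (metis ci_central mult.assoc)

lemma scaleC_mult: "scaleC z x * y = scaleC z (x * (y::'a::cstar_algebra))"
  by (simp add: scaleC_def algebra_simps mult.assoc)

lemma mult_scaleC: "x * scaleC z y = scaleC z (x * (y::'a::cstar_algebra))"
  by (simp add: scaleC_def algebra_simps ci_left_commute)

lemma scaleC_scaleC: "scaleC z (scaleC w x) = scaleC (z * w) (x::'a::cstar_algebra)"
  by (simp add: scaleC_def algebra_simps)

lemma scaleC_add_right: "scaleC z (x + y) = scaleC z x + scaleC z (y::'a::cstar_algebra)"
  by (simp add: scaleC_def algebra_simps)

lemma scaleC_add_left: "scaleC (z + w) x = scaleC z x + scaleC w (x::'a::cstar_algebra)"
  by (simp add: scaleC_def algebra_simps)

lemma adj_scaleC: "adj (scaleC z x) = scaleC (cnj z) (adj (x::'a::cstar_algebra))"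
  by (simp add: scaleC_def adj_add adj_scaleR adj_mult adj_ci ci_central)

text \<open>The element \<open>b\<close> is the binomial series of the square root of
  \<open>1 - h * h\<close>. It converges absolutely since \<open>h * h\<close> has norm below 1, and
  its terms are real multiples of powers of \<open>h\<close>, hence self-adjoint and commuting with
  \<open>h\<close>. Vandermonde's identity evaluates the Cauchy square of the series.\<close>

lemma self_adjoint_sqrt:
  fixes h :: "'a::cstar_algebra"
  assumes "adj h = h" and "norm h < 1"
  obtains b where "adj b = b" "b * h = h * b" "b * b = 1 - h * h"
proof -
  define g :: "nat \<Rightarrow> real" where "g n = (1/2) gchoose n" for n
  define f where "f n = g n *\<^sub>R (- (h * h)) ^ n" for n
  have n1: "norm (h * h) < 1"
    using cstar_identity[of h] assms by (simp add: power_less_one_iff abs_square_less_1)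
  have "summable (\<lambda>n. norm (g n * norm (h * h) ^ n))"
  proof -
    \<comment> \<open>A point strictly between \<open>norm (h * h)\<close> and 1: convergence of the
      scalar series at \<open>r\<close> yields absolute convergence at every smaller radius.\<close>
    define r where "r = (1 + norm (h * h)) / 2"
    have r: "norm (h * h) < r" "r < 1" "0 < r"
      using n1 by (auto simp: r_def add_pos_nonneg)
    have "summable (\<lambda>n. g n * r ^ n)"
      unfolding g_def using gen_binomial_real[of r "1/2"] r by (auto simp: sums_iff)
    then show ?thesis
      by (rule powser_insidea) (use r in auto)
  qed
  then have ns: "summable (\<lambda>n. norm (f n))"
    by (rule summable_comparison_test'[where N=0])
       (auto simp: f_def abs_mult intro!: mult_left_mono order.trans[OF norm_power_ineq])
  then have s: "summable f" by (rule summable_norm_cancel)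
  define b where "b = (\<Sum>n. f n)"
  have com: "f n * h = h * f n" for n
  proof -
    have "(- (h * h)) ^ n * h = h * (- (h * h)) ^ n"
      by (rule power_commuting_commutes) (simp add: mult.assoc)
    then show ?thesis by (simp add: f_def)
  qed
  have "adj b = b"
    unfolding b_def bounded_linear.suminf[OF bounded_linear_adj s]
    by (simp add: f_def[abs_def] adj_scaleR adj_power adj_mult assms)
  moreover have "b * h = h * b"
    unfolding b_def suminf_mult2[OF s] suminf_mult[OF s, symmetric] com ..
  moreover have "b * b = 1 - h * h"
  proof -
    have "(\<lambda>k. \<Sum>i\<le>k. f i * f (k - i)) sums (b * b)"
      unfolding b_def by (rule Cauchy_product_sums[OF ns ns])
    moreover have "(\<Sum>i\<le>k. f i * f (k - i)) = ((1::real) gchoose k) *\<^sub>R (- (h * h)) ^ k" for k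
    proof -
      have "(\<Sum>i\<le>k. f i * f (k - i)) = (\<Sum>i\<le>k. (g i * g (k - i)) *\<^sub>R (- (h * h)) ^ k)"
        by (rule sum.cong) (auto simp: f_def simp flip: power_add)
      also have "\<dots> = (\<Sum>i\<le>k. g i * g (k - i)) *\<^sub>R (- (h * h)) ^ k"
        by (simp add: scaleR_sum_left)
      also have "(\<Sum>i\<le>k. g i * g (k - i)) = (1 gchoose k)"
        using gbinomial_Vandermonde[of "1/2::real" "1/2" k] by (simp add: g_def atMost_atLeast0)
      finally show ?thesis .
    qed
    ultimately have "(\<lambda>k. ((1::real) gchoose k) *\<^sub>R (- (h * h)) ^ k) sums (b * b)" by simp
    \<comment> \<open>The coefficients \<open>1 gchoose k\<close> vanish for \<open>k\<close> at
      least 2, so the squared series stops after \<open>1 - h * h\<close>.\<close>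
    moreover have "(\<lambda>k. ((1::real) gchoose k) *\<^sub>R (- (h * h)) ^ k) sums
        (\<Sum>k\<in>{0,1}. ((1::real) gchoose k) *\<^sub>R (- (h * h)) ^ k)"
    proof (rule sums_finite)
      fix k :: nat assume "k \<notin> {0, 1}"
      then have "(1::real) gchoose k = 0"
        using binomial_gbinomial[of 1 k, where ?'a=real] by (simp add: binomial_eq_0)
      then show "((1::real) gchoose k) *\<^sub>R (- (h * h)) ^ k = 0" by simp
    qed simp
    ultimately show ?thesis
      by (simp add: sums_unique2)
  qed
  ultimately show thesis by (rule that)
qed

text \<open>The unitary is \<open>h + ci * b\<close> with \<open>b\<close> the square root of
  \<open>1 - h * h\<close>, the analogue of writing a cosine as the real part of a phase. Unitarity
  uses that \<open>b\<close> and \<open>h\<close> commute.\<close>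

lemma self_adjoint_half_unitary:
  fixes h :: "'a::cstar_algebra"
  assumes "adj h = h" and "norm h < 1"
  obtains u where "is_unitary u" "h = (1/2) *\<^sub>R (u + adj u)"
proof -
  obtain b where b: "adj b = b" "b * h = h * b" "b * b = 1 - h * h"
    using self_adjoint_sqrt[OF assms] .
  have a: "adj (h + ci * b) = h - ci * b"
    by (simp add: adj_add adj_mult adj_ci b assms ci_central)
  have "is_unitary (h + ci * b)"
    unfolding is_unitary_def a
    using b(2,3) by (simp add: distrib_left distrib_right left_diff_distrib right_diff_distrib
        mult.assoc ci_sq ci_left_commute[of b] ci_left_commute[of h])
  moreover have "h = (1/2) *\<^sub>R ((h + ci * b) + adj (h + ci * b))"
    unfolding a by (simp flip: scaleR_2)
  ultimately show thesis by (rule that)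
qed

text \<open>
  A self-adjoint contraction is the real part of a unitary, so a seminorm bounded on unitaries is
  controlled by the norm; this replaces spectral theory for states and automorphisms.
\<close>
lemma self_adjoint_bound_by_unitaries:
  fixes p :: "'a::cstar_algebra \<Rightarrow> real" and h :: 'a
  assumes add: "\<And>x y. p (x + y) \<le> p x + p y"
    and scale: "\<And>r x. p (r *\<^sub>R x) = \<bar>r\<bar> * p x"
    and uni: "\<And>u. is_unitary u \<Longrightarrow> p u \<le> 1"
    and h: "adj h = h"
  shows "p h \<le> norm h"
\<comment> \<open>Working with every \<open>r > norm h\<close> makes the norm of
  \<open>(1/r) *\<^sub>R h\<close> strictly less than 1, as the square root construction
  demands.\<close>
proof (rule dense_ge)
  fix r assume r: "norm h < r"
  then have r0: "0 < r" using norm_ge_zero[of h] by linarith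
  have "adj ((1/r) *\<^sub>R h) = (1/r) *\<^sub>R h" "norm ((1/r) *\<^sub>R h) < 1"
    using h r r0 by (auto simp: adj_scaleR)
  then obtain u where u: "is_unitary u" "(1/r) *\<^sub>R h = (1/2) *\<^sub>R (u + adj u)"
    using self_adjoint_half_unitary by blast
  have "is_unitary (adj u)" using u by (simp add: is_unitary_def adj_adj)
  then have "p ((1/r) *\<^sub>R h) \<le> 1"
    using add[of u "adj u"] uni[OF u(1)] uni[of "adj u"] unfolding u(2) scale by simp
  then show "p h \<le> r" using r0 unfolding scale by (simp add: field_simps)
qed

text \<open>Polarisation against the unit: positivity at \<open>x + scaleC z 1\<close> makes
  \<open>z * \<phi> (adj x) + cnj z * \<phi> x\<close> real for every \<open>z\<close>, and the
  values 1 and \<open>\<i>\<close> determine both components.\<close>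

lemma state_adj:
  assumes "is_state (\<phi> :: 'a::cstar_algebra \<Rightarrow> complex)"
  shows "\<phi> (adj x) = cnj (\<phi> x)"
proof -
  have add: "\<phi> (x + y) = \<phi> x + \<phi> y" and sc: "\<phi> (scaleC z x) = z * \<phi> x"
    and im: "Im (\<phi> (adj x * x)) = 0" and one: "\<phi> 1 = 1" for x y z
    using assms unfolding is_state_def by blast+
  have ex: "adj (x + scaleC z 1) * (x + scaleC z 1)
     = adj x * x + (scaleC z (adj x) + (scaleC (cnj z) x + scaleC (cnj z * z) 1))" for z
    by (simp add: adj_add adj_scaleC distrib_left distrib_right scaleC_mult mult_scaleC scaleC_scaleC
         scaleC_add_right add_ac mult.commute)
  have "Im (z * \<phi> (adj x) + cnj z * \<phi> x) = 0" for z
    using im[of "x + scaleC z 1"] im[of x] unfolding ex add sc one by simp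
  from this[of 1] this[of \<i>] show ?thesis
    by (simp add: complex_eq_iff)
qed

text \<open>Nonnegativity of a variance: the choice \<open>z = - \<phi> x\<close> centres
  \<open>x\<close>, and the state evaluated on the square of the centred element is the difference
  of the two sides.\<close>

lemma state_cauchy_schwarz:
  assumes "is_state (\<phi> :: 'a::cstar_algebra \<Rightarrow> complex)"
  shows "(cmod (\<phi> x))\<^sup>2 \<le> Re (\<phi> (adj x * x))"
proof -
  have add: "\<phi> (x + y) = \<phi> x + \<phi> y" and sc: "\<phi> (scaleC z x) = z * \<phi> x"
    and re: "Re (\<phi> (adj x * x)) \<ge> 0" and one: "\<phi> 1 = 1" for x y z
    using assms unfolding is_state_def by blast+
  define z where "z = - \<phi> x"
  have ex: "adj (x + scaleC z 1) * (x + scaleC z 1)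
     = adj x * x + (scaleC z (adj x) + (scaleC (cnj z) x + scaleC (cnj z * z) 1))"
    by (simp add: adj_add adj_scaleC distrib_left distrib_right scaleC_mult mult_scaleC scaleC_scaleC
         scaleC_add_right add_ac mult.commute)
  have "0 \<le> Re (\<phi> (adj x * x) + (z * cnj (\<phi> x) + (cnj z * \<phi> x + cnj z * z)))"
    using re[of "x + scaleC z 1"] unfolding ex add sc one state_adj[OF assms] by simp
  then show ?thesis
    unfolding cmod_power2 by (simp add: z_def power2_eq_square)
qed

text \<open>Cauchy-Schwarz bounds the state by 1 on unitaries. The seminorm principle then covers
  the self-adjoint element \<open>adj x * x\<close>, and the C*-identity passes from there to
  \<open>x\<close>.\<close>

lemma state_bounded:
  assumes st: "is_state (\<phi> :: 'a::cstar_algebra \<Rightarrow> complex)"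
  shows "cmod (\<phi> x) \<le> norm x"
proof -
  have add: "\<phi> (x + y) = \<phi> x + \<phi> y" and sc: "\<phi> (scaleC z x) = z * \<phi> x"
    and one: "\<phi> 1 = 1" for x y z
    using st unfolding is_state_def by blast+
  have "cmod (\<phi> (adj x * x)) \<le> norm (adj x * x)"
  proof (rule self_adjoint_bound_by_unitaries[where p="\<lambda>x. cmod (\<phi> x)"])
    fix u :: 'a assume "is_unitary u"
    then show "cmod (\<phi> u) \<le> 1"
      using state_cauchy_schwarz[OF st, of u] by (simp add: is_unitary_def one abs_square_le_1)
  qed (simp_all add: add norm_triangle_ineq adj_mult adj_adj sc norm_mult flip: scaleC_of_real)
  then have "(cmod (\<phi> x))\<^sup>2 \<le> (norm x)\<^sup>2"
    using state_cauchy_schwarz[OF st, of x] complex_Re_le_cmod[of "\<phi> (adj x * x)"]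
    unfolding cstar_identity by linarith
  then show ?thesis by (rule power2_le_imp_le) simp
qed

text \<open>Unitaries are sent to unitaries, which have norm 1, so the same seminorm principle and
  the C*-identity apply.\<close>

lemma star_automorphism_norm_le:
  assumes "is_star_automorphism (f :: 'a::cstar_algebra \<Rightarrow> 'a)"
  shows "norm (f x) \<le> norm x"
proof -
  have f: "f (x + y) = f x + f y" "f (x * y) = f x * f y" "f (scaleC z x) = scaleC z (f x)"
     "f (adj x) = adj (f x)" "f 1 = 1" for x y z
    using assms unfolding is_star_automorphism_def by blast+
  have "norm (f (adj x * x)) \<le> norm (adj x * x)"
  proof (rule self_adjoint_bound_by_unitaries[where p="\<lambda>x. norm (f x)"])
    fix u :: 'a assume "is_unitary u"
    then have "is_unitary (f u)" unfolding is_unitary_def by (metis f(2,4,5))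
    then show "norm (f u) \<le> 1" using norm_unitary by fastforce
  qed (simp_all add: f norm_triangle_ineq adj_mult adj_adj norm_scaleC flip: scaleC_of_real)
  then have "(norm (f x))\<^sup>2 \<le> (norm x)\<^sup>2"
    by (simp add: f(2,4) cstar_identity)
  then show ?thesis by (rule power2_le_imp_le) simp
qed

section \<open>Perturbation of exponentials of skew-adjoint elements\<close>

lemma deriv_bound_01:
  fixes f :: "real \<Rightarrow> 'b::real_normed_vector"
  assumes der: "\<And>s. s \<in> {0..1} \<Longrightarrow> (f has_vector_derivative f' s) (at s within {0..1})"
    and B: "\<And>s. s \<in> {0..1} \<Longrightarrow> norm (f' s) \<le> B"
  shows "norm (f 1 - f 0) \<le> B"
proof -
  have "norm (f 1 - f 0) \<le> B * norm (1 - 0 :: real)"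
  proof (rule differentiable_bound[where S="{0..1}" and f'="\<lambda>s h. h *\<^sub>R f' s"])
    fix s :: real assume s: "s \<in> {0..1}"
    show "(f has_derivative (\<lambda>h. h *\<^sub>R f' s)) (at s within {0..1})"
      using der[OF s] by (simp add: has_vector_derivative_def)
    show "onorm (\<lambda>h. h *\<^sub>R f' s) \<le> B"
      using B[OF s] by (intro onorm_le) (simp add: mult.commute[of B] mult_left_mono)
  qed auto
  then show ?thesis by simp
qed

text \<open>The basis of all Duhamel-type estimates below. Taking \<open>C = 1\<close> and
  \<open>B = A + R\<close> compares two exponentials, while \<open>B = A\<close> measures a
  commutator.\<close>

lemma exp_conj_has_vector_derivative:
  fixes A B :: "'a::{real_normed_algebra_1,banach}"
  shows "((\<lambda>s. exp (- (s *\<^sub>R A)) * C * exp (s *\<^sub>R B)) has_vector_derivative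
     exp (- (s *\<^sub>R A)) * (C * B - A * C) * exp (s *\<^sub>R B)) (at s within T)"
proof -
  have "((\<lambda>s. exp (s *\<^sub>R (- A)) * (C * exp (s *\<^sub>R B))) has_vector_derivative
     exp (s *\<^sub>R (- A)) * (C * (B * exp (s *\<^sub>R B))) + (exp (s *\<^sub>R (- A)) * (- A)) * (C * exp (s *\<^sub>R B)))
     (at s within T)"
    by (intro has_vector_derivative_mult exp_scaleR_has_vector_derivative_right
        has_vector_derivative_mult_right[OF has_vector_derivative_at_within[OF exp_scaleR_has_vector_derivative_left]])
  then show ?thesis
    by (simp add: algebra_simps mult.assoc)
qed

lemma norm_mult_exp_skew_le:
  fixes x :: "'a::cstar_algebra"
  assumes "adj A = - A" "adj B = - B"
  shows "norm (exp A * x * exp B) \<le> norm x"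
proof -
  have "norm (exp A * x * exp B) \<le> norm (exp A) * norm x * norm (exp B)"
    by (intro order.trans[OF norm_mult_ineq] mult_right_mono norm_mult_ineq) auto
  then show ?thesis by (simp add: norm_exp_skew assms)
qed

lemma norm_exp_skew_mult [simp]:
  fixes x :: "'a::cstar_algebra"
  assumes "adj A = - A"
  shows "norm (exp A * x) = norm x"
proof (rule antisym)
  show "norm (exp A * x) \<le> norm x"
    using norm_mult_exp_skew_le[OF assms, of 0 x] by simp
  have "x = exp (- A) * (exp A * x)"
    using exp_minus_inverse[of "- A"] by (simp flip: mult.assoc)
  then have "norm x = norm (exp (- A) * (exp A * x))" by simp
  also have "\<dots> \<le> norm (exp A * x)"
    using norm_mult_exp_skew_le[of "- A" 0 "exp A * x"] assms by simp
  finally show "norm x \<le> norm (exp A * x)" .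
qed

text \<open>Along the path \<open>exp (- (s *\<^sub>R A)) * exp (s *\<^sub>R (A + R))\<close> the
  derivative is \<open>R\<close> between two unitaries. The bound is therefore free of
  \<open>norm A\<close>, which matters because the exponents may grow with the volume.\<close>

lemma exp_skew_perturb:
  fixes A R :: "'a::cstar_algebra"
  assumes A: "adj A = - A" and R: "adj R = - R"
  shows "norm (exp (A + R) - exp A) \<le> norm R"
proof -
  define f where "f s = exp (- (s *\<^sub>R A)) * 1 * exp (s *\<^sub>R (A + R))" for s :: real
  have "norm (f 1 - f 0) \<le> norm R"
  proof (rule deriv_bound_01)
    fix s :: real
    show "(f has_vector_derivative exp (- (s *\<^sub>R A)) * (1 * (A + R) - A * 1) * exp (s *\<^sub>R (A + R)))
       (at s within {0..1})"
      unfolding f_def[abs_def] by (rule exp_conj_has_vector_derivative)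
    show "norm (exp (- (s *\<^sub>R A)) * (1 * (A + R) - A * 1) * exp (s *\<^sub>R (A + R))) \<le> norm R"
      using norm_mult_exp_skew_le[of "- (s *\<^sub>R A)" "s *\<^sub>R (A + R)" R]
      by (simp add: adj_scaleR adj_add A R algebra_simps)
  qed
  moreover have "exp (A + R) - exp A = exp A * (f 1 - f 0)"
    using exp_minus_inverse[of A] by (simp add: f_def right_diff_distrib flip: mult.assoc)
  ultimately show ?thesis by (simp add: A)
qed

text \<open>Conjugating \<open>S\<close> by the unitaries \<open>exp (s *\<^sub>R A)\<close> moves
  it at speed at most the norm of the commutator.\<close>

lemma exp_skew_commutator:
  fixes A S :: "'a::cstar_algebra"
  assumes A: "adj A = - A"
  shows "norm (S * exp A - exp A * S) \<le> norm (A * S - S * A)"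
proof -
  define f where "f s = exp (- (s *\<^sub>R A)) * S * exp (s *\<^sub>R A)" for s :: real
  have "norm (f 1 - f 0) \<le> norm (S * A - A * S)"
  proof (rule deriv_bound_01)
    fix s :: real
    show "(f has_vector_derivative exp (- (s *\<^sub>R A)) * (S * A - A * S) * exp (s *\<^sub>R A))
       (at s within {0..1})"
      unfolding f_def[abs_def] by (rule exp_conj_has_vector_derivative)
    show "norm (exp (- (s *\<^sub>R A)) * (S * A - A * S) * exp (s *\<^sub>R A)) \<le> norm (S * A - A * S)"
      by (rule norm_mult_exp_skew_le) (simp_all add: adj_scaleR A)
  qed
  moreover have "S * exp A - exp A * S = exp A * (f 1 - f 0)"
    using exp_minus_inverse[of A] by (simp add: f_def right_diff_distrib flip: mult.assoc)
  ultimately show ?thesis by (simp add: A norm_minus_commute)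
qed

text \<open>The Duhamel path with its expected linear part \<open>s *\<^sub>R R\<close> subtracted.
  What remains of the derivative is a term quadratic in \<open>R\<close> and the cost of moving
  \<open>R\<close> past an exponential of \<open>A\<close>.\<close>

lemma exp_skew_first_order:
  fixes A R :: "'a::cstar_algebra"
  assumes A: "adj A = - A" and R: "adj R = - R"
  shows "norm (exp (A + R) - exp A * (1 + R)) \<le> (norm R)\<^sup>2 + norm (A * R - R * A)"
proof -
  define g where "g s = exp (- (s *\<^sub>R A)) * 1 * exp (s *\<^sub>R (A + R)) - s *\<^sub>R R" for s :: real
  define g' where "g' s = exp (- (s *\<^sub>R A)) * (1 * (A + R) - A * 1) * exp (s *\<^sub>R (A + R)) - R" for s :: real
  have "norm (g 1 - g 0) \<le> (norm R)\<^sup>2 + norm (A * R - R * A)"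
  proof (rule deriv_bound_01)
    fix s :: real assume s: "s \<in> {0..1}"
    show "(g has_vector_derivative g' s) (at s within {0..1})"
      unfolding g_def[abs_def] g'_def
      by (intro has_vector_derivative_diff exp_conj_has_vector_derivative)
         (auto intro!: derivative_eq_intros)
    define E where "E = exp (- (s *\<^sub>R A))"
    define F where "F = exp (s *\<^sub>R (A + R))"
    have sk: "adj (s *\<^sub>R A) = - (s *\<^sub>R A)" "adj (s *\<^sub>R R) = - (s *\<^sub>R R)"
      "adj (s *\<^sub>R (A + R)) = - (s *\<^sub>R (A + R))" "adj (- (s *\<^sub>R A)) = - (- (s *\<^sub>R A))"
      by (simp_all add: adj_scaleR adj_add A R algebra_simps)
    have "E * F - 1 = E * (exp (s *\<^sub>R A + s *\<^sub>R R) - exp (s *\<^sub>R A))"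
      using exp_minus_inverse[of "- (s *\<^sub>R A)"] by (simp add: E_def F_def scaleR_add_right right_diff_distrib)
    then have "norm (E * F - 1) \<le> norm (s *\<^sub>R R)"
      using exp_skew_perturb[OF sk(1,2)] unfolding E_def by (simp add: norm_exp_skew_mult[OF sk(4)])
    then have EF: "norm (E * F - 1) \<le> norm R"
      using s mult_right_mono[of s 1 "norm R"] by simp
    have "norm (R * E - E * R) \<le> norm (- (s *\<^sub>R A) * R - R * (- (s *\<^sub>R A)))"
      unfolding E_def by (rule exp_skew_commutator[OF sk(4)])
    also have "- (s *\<^sub>R A) * R - R * (- (s *\<^sub>R A)) = - (s *\<^sub>R (A * R - R * A))"
      by (simp add: algebra_simps)
    also have "norm \<dots> \<le> norm (A * R - R * A)"
      using s mult_right_mono[of s 1 "norm (A * R - R * A)"] by simp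
    finally have com: "norm (R * E - E * R) \<le> norm (A * R - R * A)" .
    \<comment> \<open>The derivative is \<open>E * R * F - R\<close>; moving \<open>R\<close> to the
      front separates the quadratic part from the commutator.\<close>
    have "g' s = R * (E * F - 1) - (R * E - E * R) * F"
      by (simp add: g'_def E_def F_def algebra_simps mult.assoc)
    also have "norm \<dots> \<le> norm R * norm (E * F - 1) + norm (R * E - E * R) * norm F"
      by (intro order.trans[OF norm_triangle_ineq4] add_mono norm_mult_ineq)
    also have "\<dots> \<le> norm R * norm R + norm (A * R - R * A) * 1"
      using EF com by (intro add_mono mult_mono) (simp_all add: F_def norm_exp_skew sk)
    finally show "norm (g' s) \<le> (norm R)\<^sup>2 + norm (A * R - R * A)"
      by (simp add: power2_eq_square)
  qed
  moreover have "exp (A + R) - exp A * (1 + R) = exp A * (g 1 - g 0)"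
    using exp_minus_inverse[of A] by (simp add: g_def algebra_simps flip: mult.assoc)
  ultimately show ?thesis by (simp add: A)
qed

section \<open>Ordered products of exponentials of skew-adjoint elements\<close>

lemma norm_prod_list_exp_skew:
  fixes A :: "'b \<Rightarrow> 'a::cstar_algebra"
  assumes "\<And>y. y \<in> set ys \<Longrightarrow> adj (A y) = - A y"
  shows "norm (prod_list (map (\<lambda>y. exp (A y)) ys)) = 1"
  using assms by (induction ys) simp_all

text \<open>Telescoping: factors are replaced one at a time, and all the others have norm 1.\<close>

lemma prod_list_exp_skew_perturb:
  fixes A R :: "'b \<Rightarrow> 'a::cstar_algebra" and \<rho> :: real
  assumes "\<And>y. y \<in> set ys \<Longrightarrow> adj (A y) = - A y"
    and "\<And>y. y \<in> set ys \<Longrightarrow> adj (R y) = - R y"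
    and "\<And>y. y \<in> set ys \<Longrightarrow> norm (R y) \<le> \<rho>"
  shows "norm (prod_list (map (\<lambda>y. exp (A y + R y)) ys) - prod_list (map (\<lambda>y. exp (A y)) ys))
     \<le> length ys * \<rho>"
  using assms
proof (induction ys)
  case (Cons y ys)
  define T where "T = prod_list (map (\<lambda>y. exp (A y + R y)) ys)"
  define V where "V = prod_list (map (\<lambda>y. exp (A y)) ys)"
  have IH: "norm (T - V) \<le> length ys * \<rho>"
    unfolding T_def V_def by (rule Cons.IH) (use Cons.prems in auto)
  have T: "norm T = 1"
    unfolding T_def by (rule norm_prod_list_exp_skew) (use Cons.prems in \<open>auto simp: adj_add\<close>)
  have "exp (A y + R y) * T - exp (A y) * V = (exp (A y + R y) - exp (A y)) * T + exp (A y) * (T - V)"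
    by (simp add: algebra_simps)
  also have "norm \<dots> \<le> norm (exp (A y + R y) - exp (A y)) * norm T + norm (exp (A y) * (T - V))"
    by (intro norm_triangle_mono norm_mult_ineq order.refl)
  also have "\<dots> \<le> \<rho> + length ys * \<rho>"
    using exp_skew_perturb[of "A y" "R y"] Cons.prems IH T by (fastforce intro!: add_mono)
  finally show ?case by (simp add: T_def V_def algebra_simps)
qed simp

text \<open>Appending a factor \<open>v\<close> requires moving the collected first-order term
  \<open>S\<close> to its right. This costs one commutator per earlier factor, whence the quadratic
  dependence on the length.\<close>

lemma prod_list_exp_skew_first_order:
  fixes A R :: "'b \<Rightarrow> 'a::cstar_algebra" and \<rho> :: real
  assumes "\<And>y. y \<in> set ys \<Longrightarrow> adj (A y) = - A y"
    and "\<And>y. y \<in> set ys \<Longrightarrow> adj (R y) = - R y"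
    and "\<And>y. y \<in> set ys \<Longrightarrow> norm (R y) \<le> \<rho>"
    and "\<And>y y'. y \<in> set ys \<Longrightarrow> y' \<in> set ys \<Longrightarrow> norm (A y * R y' - R y' * A y) \<le> \<kappa>"
  shows "norm (prod_list (map (\<lambda>y. exp (A y + R y)) ys)
        - prod_list (map (\<lambda>y. exp (A y)) ys) * (1 + sum_list (map R ys)))
     \<le> (real (length ys))\<^sup>2 * (\<rho>\<^sup>2 + \<kappa>)"
  using assms
proof (induction ys rule: rev_induct)
  case (snoc y ys)
  define k where "k = real (length ys)"
  define T where "T = prod_list (map (\<lambda>y. exp (A y + R y)) ys)"
  define V where "V = prod_list (map (\<lambda>y. exp (A y)) ys)"
  define S where "S = sum_list (map R ys)"
  define u where "u = exp (A y + R y)"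
  define v where "v = exp (A y)"
  have sk: "adj (A y) = - A y" "adj (R y) = - R y" and \<rho>: "norm (R y) \<le> \<rho>"
    using snoc.prems by auto
  have "norm (A y * R y - R y * A y) \<le> \<kappa>" using snoc.prems by simp
  then have \<rho>0: "0 \<le> \<rho>" and \<kappa>0: "0 \<le> \<kappa>"
    using \<rho> norm_ge_zero order.trans by blast+
  have IH: "norm (T - V * (1 + S)) \<le> k\<^sup>2 * (\<rho>\<^sup>2 + \<kappa>)"
    unfolding T_def V_def S_def k_def by (rule snoc.IH) (use snoc.prems in auto)
  have V: "norm V = 1"
    unfolding V_def by (rule norm_prod_list_exp_skew) (use snoc.prems in auto)
  have u: "norm u = 1"
    unfolding u_def by (rule norm_exp_skew) (simp add: adj_add sk)
  have S: "norm S \<le> k * \<rho>"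
    using snoc.prems(3) unfolding S_def k_def
  proof (induction ys)
    case (Cons a ys)
    then have "norm (R a + sum_list (map R ys)) \<le> \<rho> + length ys * \<rho>"
      by (intro norm_triangle_mono) auto
    then show ?case by (simp add: algebra_simps)
  qed simp
  have "norm (A y * S - S * A y) \<le> k * \<kappa>"
    using snoc.prems(4) unfolding S_def k_def
  proof (induction ys)
    case (Cons a ys)
    then have "norm ((A y * R a - R a * A y) + (A y * sum_list (map R ys) - sum_list (map R ys) * A y))
        \<le> \<kappa> + length ys * \<kappa>"
      by (intro norm_triangle_mono) auto
    then show ?case by (simp add: algebra_simps)
  qed simp
  then have com: "norm (S * v - v * S) \<le> k * \<kappa>"
    unfolding v_def using exp_skew_commutator[OF sk(1), of S] by linarith
  have uv: "norm (u - v) \<le> \<rho>"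
    unfolding u_def v_def using exp_skew_perturb[OF sk] \<rho> by linarith
  have uv1: "norm (u - v * (1 + R y)) \<le> \<rho>\<^sup>2 + \<kappa>"
  proof -
    have "(norm (R y))\<^sup>2 \<le> \<rho>\<^sup>2" using \<rho> by (intro power_mono) auto
    then show ?thesis
      unfolding u_def v_def using exp_skew_first_order[OF sk] snoc.prems(4)[of y y] by simp
  qed
  \<comment> \<open>Four errors: the earlier factors, the expansion of the new factor, the
    second-order cross term \<open>S * (u - v)\<close>, and the exchange of \<open>S\<close> with
    \<open>v\<close>.\<close>
  have "T * u - V * v * (1 + (S + R y))
      = (T - V * (1 + S)) * u + V * ((u - v * (1 + R y)) + (S * (u - v) + (S * v - v * S)))"
    by (simp add: algebra_simps mult.assoc)
  also have "norm \<dots> \<le> norm (T - V * (1 + S)) * norm u +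
       norm V * (norm (u - v * (1 + R y)) + (norm S * norm (u - v) + norm (S * v - v * S)))"
    by (intro norm_triangle_mono order.trans[OF norm_mult_ineq] mult_left_mono norm_mult_ineq) auto
  also have "\<dots> \<le> k\<^sup>2 * (\<rho>\<^sup>2 + \<kappa>) + ((\<rho>\<^sup>2 + \<kappa>) + (k * \<rho> * \<rho> + k * \<kappa>))"
    unfolding u V using IH uv1 com uv S \<rho>0
    by (simp only: mult_1_left mult_1_right) (intro add_mono mult_mono, auto simp: k_def)
  also have "\<dots> = (k\<^sup>2 + k + 1) * (\<rho>\<^sup>2 + \<kappa>)"
    by (simp add: algebra_simps power2_eq_square)
  also have "\<dots> \<le> (k + 1)\<^sup>2 * (\<rho>\<^sup>2 + \<kappa>)"
    using \<kappa>0 by (intro mult_right_mono) (auto simp: power2_sum k_def)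
  finally show ?case
    by (simp add: T_def V_def S_def u_def v_def k_def add.commute)
qed simp

section \<open>Local observables and their fluctuations\<close>

lemma fin_intervals_atLeastAtMost [simp]: "a \<le> b \<Longrightarrow> {a..b} \<in> fin_intervals"
  by (auto simp: fin_intervals_def)

locale lattice_state =
  fixes T :: "'i itself" and M :: "int set \<Rightarrow> 'a::cstar_algebra set"
    and \<gamma> :: "int \<Rightarrow> 'a \<Rightarrow> 'a" and chi :: "'a \<Rightarrow> complex"
  assumes quasi_local: "quasi_local T M"
    and translation_action: "translation_action M \<gamma>"
    and product_invariant_state: "product_invariant_state M \<gamma> chi"
begin

lemma state_chi: "is_state chi"
  using product_invariant_state by (simp add: product_invariant_state_def)

lemma chi_add: "chi (x + y) = chi x + chi y"
  and chi_scaleC: "chi (scaleC z x) = z * chi x"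
  and chi_1: "chi 1 = 1"
  using state_chi unfolding is_state_def by blast+

lemma chi_scaleR: "chi (r *\<^sub>R x) = of_real r * chi x"
  using chi_scaleC[of "of_real r" x] by (simp add: scaleC_of_real)

lemma chi_ci: "chi (ci * x) = \<i> * chi x"
  using chi_scaleC[of \<i> x] by (simp add: scaleC_ii)

lemma chi_bound: "cmod (chi x) \<le> norm x"
  by (rule state_bounded[OF state_chi])

lemma bounded_linear_chi: "bounded_linear chi"
  by (rule bounded_linear_intro[where K=1])
     (simp_all add: chi_add chi_scaleR chi_bound scaleR_conv_of_real[where 'a=complex])

lemmas chi_diff = linear_diff[OF bounded_linear.linear[OF bounded_linear_chi]]
  and chi_sum = linear_sum[OF bounded_linear.linear[OF bounded_linear_chi]]

lemma chi_adj: "chi (adj x) = cnj (chi x)"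
  by (rule state_adj[OF state_chi])

lemma chi_translate: "chi (\<gamma> j x) = chi x"
  using product_invariant_state by (simp add: product_invariant_state_def)

lemma chi_mult:
  assumes "x \<in> M {a..b}" "y \<in> M {c..d}" "{a..b} \<inter> {c..d} = {}" "a \<le> b" "c \<le> d"
  shows "chi (x * y) = chi x * chi y"
  using product_invariant_state assms fin_intervals_atLeastAtMost unfolding product_invariant_state_def by blast

lemma automorphism: "is_star_automorphism (\<gamma> j)"
  using translation_action by (simp add: translation_action_def)

lemma trans_add: "\<gamma> j (x + y) = \<gamma> j x + \<gamma> j y"
  and trans_mult: "\<gamma> j (x * y) = \<gamma> j x * \<gamma> j y"
  and trans_scaleC: "\<gamma> j (scaleC z x) = scaleC z (\<gamma> j x)"
  and trans_adj: "\<gamma> j (adj x) = adj (\<gamma> j x)"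
  using automorphism[of j] unfolding is_star_automorphism_def by blast+

lemma trans_scaleR: "\<gamma> j (r *\<^sub>R x) = r *\<^sub>R \<gamma> j x"
  using trans_scaleC[of j "of_real r" x] by (simp add: scaleC_of_real)

lemma trans_trans: "\<gamma> j (\<gamma> k x) = \<gamma> (j + k) x"
  and trans_0: "\<gamma> 0 x = x"
  using translation_action by (simp_all add: translation_action_def)

lemma trans_norm_le: "norm (\<gamma> j x) \<le> norm x"
  by (rule star_automorphism_norm_le[OF automorphism])

lemma trans_mem:
  assumes "x \<in> M {a..b}" "a \<le> b"
  shows "\<gamma> j x \<in> M {a + j..b + j}"
proof -
  have "\<gamma> j ` M {a..b} = M ((\<lambda>n. n + j) ` {a..b})"
    using translation_action fin_intervals_atLeastAtMost[OF assms(2)] unfolding translation_action_def by blast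
  also have "(\<lambda>n. n + j) ` {a..b} = {a + j..b + j}"
    by (simp add: image_add_atLeastAtMost' )
  finally show ?thesis using assms(1) by blast
qed

lemma mono_M: "\<lbrakk>a \<le> b; c \<le> a; b \<le> d; x \<in> M {a..b}\<rbrakk> \<Longrightarrow> x \<in> M {c..d}"
proof -
  assume *: "a \<le> b" "c \<le> a" "b \<le> d" "x \<in> M {a..b}"
  then have "{a..b} \<in> fin_intervals" "{c..d} \<in> fin_intervals" "{a..b} \<subseteq> {c..d}"
    by auto
  moreover have "\<forall>I\<in>fin_intervals. \<forall>J\<in>fin_intervals. I \<subseteq> J \<longrightarrow> M I \<subseteq> M J"
    using quasi_local unfolding quasi_local_def by (elim conjE)
  ultimately show "x \<in> M {c..d}"
    using *(4) by blast
qed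

lemma commute_M:
  assumes "x \<in> M {a..b}" "y \<in> M {c..d}" "{a..b} \<inter> {c..d} = {}" "a \<le> b" "c \<le> d"
  shows "x * y = y * x"
proof -
  have "\<forall>I\<in>fin_intervals. \<forall>J\<in>fin_intervals. I \<inter> J = {} \<longrightarrow> (\<forall>x\<in>M I. \<forall>y\<in>M J. x * y = y * x)"
    using quasi_local unfolding quasi_local_def by (elim conjE)
  then show ?thesis using assms fin_intervals_atLeastAtMost by blast
qed

lemma subalgebra: "a \<le> b \<Longrightarrow> is_cstar_subalgebra (M {a..b})"
  using quasi_local by (simp add: quasi_local_def)

lemma M_1: "a \<le> b \<Longrightarrow> 1 \<in> M {a..b}"
  and M_add: "a \<le> b \<Longrightarrow> x \<in> M {a..b} \<Longrightarrow> y \<in> M {a..b} \<Longrightarrow> x + y \<in> M {a..b}"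
  and M_mult: "a \<le> b \<Longrightarrow> x \<in> M {a..b} \<Longrightarrow> y \<in> M {a..b} \<Longrightarrow> x * y \<in> M {a..b}"
  and M_scaleC: "a \<le> b \<Longrightarrow> x \<in> M {a..b} \<Longrightarrow> scaleC z x \<in> M {a..b}"
  and M_closed: "a \<le> b \<Longrightarrow> closed (M {a..b})"
  using subalgebra[of a b] unfolding is_cstar_subalgebra_def by blast+

lemma M_scaleR: "a \<le> b \<Longrightarrow> x \<in> M {a..b} \<Longrightarrow> r *\<^sub>R x \<in> M {a..b}"
  using M_scaleC[of a b x "of_real r"] by (simp add: scaleC_of_real)

lemma M_ci: "a \<le> b \<Longrightarrow> x \<in> M {a..b} \<Longrightarrow> ci * x \<in> M {a..b}"
  using M_scaleC[of a b x \<i>] by (simp add: scaleC_ii)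

lemma M_0: "a \<le> b \<Longrightarrow> 0 \<in> M {a..b}"
  using M_scaleC[OF _ M_1, of a b 0] by simp

lemma M_diff: "a \<le> b \<Longrightarrow> x \<in> M {a..b} \<Longrightarrow> y \<in> M {a..b} \<Longrightarrow> x - y \<in> M {a..b}"
  using M_add[of a b x "(-1) *\<^sub>R y"] M_scaleR[of a b y "-1"] by simp

lemma M_sum: "a \<le> b \<Longrightarrow> (\<And>j. j \<in> S \<Longrightarrow> f j \<in> M {a..b}) \<Longrightarrow> sum f S \<in> M {a..b}"
  by (induction S rule: infinite_finite_induct) (simp_all add: M_0 M_add)

lemma M_sum_list: "a \<le> b \<Longrightarrow> set ys \<subseteq> M {a..b} \<Longrightarrow> sum_list ys \<in> M {a..b}"
  by (induction ys) (simp_all add: M_0 M_add)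

lemma M_power: "a \<le> b \<Longrightarrow> x \<in> M {a..b} \<Longrightarrow> x ^ n \<in> M {a..b}"
  by (induction n) (simp_all add: M_1 M_mult)

lemma M_exp:
  assumes "a \<le> b" "x \<in> M {a..b}"
  shows "exp x \<in> M {a..b}"
proof (rule closed_sequentially[OF M_closed[OF assms(1)]])
  show "(\<lambda>n. \<Sum>k<n. x ^ k /\<^sub>R fact k) \<longlonglongrightarrow> exp x"
    using exp_converges[of x] by (simp add: sums_def)
  show "(\<Sum>k<n. x ^ k /\<^sub>R fact k) \<in> M {a..b}" for n
    using assms by (auto intro!: M_sum M_scaleR M_power)
qed

section \<open>Centred translates and their normalised sums\<close>

definition site :: "int \<Rightarrow> 'a \<Rightarrow> 'a" where
  "site j x = \<gamma> j x - scaleC (chi x) 1"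

text \<open>The normalisation \<open>r\<close> is separate from \<open>S\<close>, so that sums over
  subsets keep the normalisation of the full interval and \<open>field\<close> is additive over
  disjoint sets of sites. The factor \<open>ci\<close> makes it skew-adjoint for self-adjoint
  \<open>x\<close>.\<close>

definition field :: "real \<Rightarrow> int set \<Rightarrow> 'a \<Rightarrow> 'a" where
  "field r S x = r *\<^sub>R (ci * (\<Sum>j\<in>S. site j x))"

lemma ci_fluct: "ci * fluct \<gamma> chi S x = field (1 / sqrt (card S)) S x"
  by (simp add: fluct_def field_def site_def)

lemma site_add: "site j (x + y) = site j x + site j y"
  by (simp add: site_def trans_add chi_add scaleC_add_left)

lemma site_scaleR: "site j (t *\<^sub>R x) = t *\<^sub>R site j x"
  by (simp add: site_def trans_scaleR chi_scaleR scaleR_diff_right) (simp add: scaleC_scaleC flip: scaleC_of_real)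

lemma adj_site: "adj x = x \<Longrightarrow> adj (site j x) = site j x"
  by (simp add: site_def adj_diff adj_scaleC flip: trans_adj chi_adj)

lemma norm_site: "norm (site j x) \<le> 2 * norm x"
proof -
  have "norm (site j x) \<le> norm (\<gamma> j x) + norm (scaleC (chi x) (1::'a))"
    unfolding site_def by (rule norm_triangle_ineq4)
  then show ?thesis
    using trans_norm_le[of j x] chi_bound[of x] by (simp add: norm_scaleC)
qed

lemma chi_site: "chi (site j x) = 0"
  by (simp add: site_def chi_diff chi_scaleC chi_translate chi_1)

lemma site_mem: "a \<le> b \<Longrightarrow> x \<in> M {a..b} \<Longrightarrow> site j x \<in> M {a + j..b + j}"
  by (simp add: site_def M_diff M_scaleC M_1 trans_mem)

lemma chi_site_site: "chi (site j x * site k y) = chi (x * \<gamma> (k - j) y) - chi x * chi y"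
proof -
  have "chi (\<gamma> j x * \<gamma> k y) = chi (\<gamma> j (x * \<gamma> (k - j) y))"
    by (simp add: trans_mult trans_trans)
  then show ?thesis
    by (simp add: site_def left_diff_distrib right_diff_distrib chi_diff scaleC_mult mult_scaleC
        chi_scaleC chi_translate chi_1)
qed

lemma field_add: "field r S (x + y) = field r S x + field r S y"
  by (simp add: field_def site_add sum.distrib algebra_simps)

lemma field_scaleR: "field r S (t *\<^sub>R x) = t *\<^sub>R field r S x"
  by (simp add: field_def site_scaleR flip: scaleR_sum_right)

lemma field_0: "field r S 0 = 0"
  using field_scaleR[of r S 0 0] by simp

lemma field_sum_list: "field r S (sum_list ys) = sum_list (map (field r S) ys)"
  by (induction ys) (simp_all add: field_0 field_add)

lemma field_Un:
  "finite A \<Longrightarrow> finite B \<Longrightarrow> A \<inter> B = {} \<Longrightarrow> field r (A \<union> B) x = field r A x + field r B x"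
  by (simp add: field_def sum.union_disjoint algebra_simps)

lemma adj_field: "adj x = x \<Longrightarrow> adj (field r S x) = - field r S x"
  by (simp add: field_def adj_scaleR adj_mult adj_ci adj_sum adj_site ci_central)

lemma norm_field: "norm (field r S x) \<le> \<bar>r\<bar> * (card S * (2 * norm x))"
proof -
  have "norm (\<Sum>j\<in>S. site j x) \<le> card S * (2 * norm x)"
    using sum_norm_bound[of S "\<lambda>j. site j x" "2 * norm x"] norm_site by simp
  then show ?thesis by (simp add: field_def mult_left_mono)
qed

lemma field_mem:
  assumes "a \<le> b" "c \<le> d" "x \<in> M {a..b}" "\<And>j. j \<in> S \<Longrightarrow> c \<le> a + j \<and> b + j \<le> d"
  shows "field r S x \<in> M {c..d}"
  unfolding field_def using assms
  by (intro M_scaleR M_ci M_sum mono_M[OF _ _ _ site_mem[OF assms(1,3)]]) auto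

abbreviation expprod :: "real \<Rightarrow> int set \<Rightarrow> 'a list \<Rightarrow> 'a" where
  "expprod r S ys \<equiv> prod_list (map (\<lambda>y. exp (field r S y)) ys)"

lemma norm_expprod:
  assumes "\<And>y. y \<in> set ys \<Longrightarrow> adj y = y"
  shows "norm (expprod r S ys) = 1"
  by (rule norm_prod_list_exp_skew) (simp add: adj_field assms)

text \<open>Commutation and independence are available for intervals, whereas the region far from
  \<open>j\<close> has two components; each component is treated on its own.\<close>

lemma field_far_split:
  assumes "1 \<le> D" "finite S"
  shows "field r {i \<in> S. D \<le> \<bar>i - j\<bar>} y = field r {i \<in> S. i \<le> j - D} y + field r {i \<in> S. j + D \<le> i} y"
proof -
  have "{i \<in> S. D \<le> \<bar>i - j\<bar>} = {i \<in> S. i \<le> j - D} \<union> {i \<in> S. j + D \<le> i}"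
    using assms by auto
  then show ?thesis
    using assms by (simp only:) (rule field_Un, auto)
qed

section \<open>Factorisation across an interval \<open>{e..f}\<close> around \<open>j\<close> that
  the supports of the far sites avoid\<close>

context
  fixes a b lo hi j D e f :: int and S :: "int set"
  assumes ab: "a \<le> b" and S: "S = {lo..hi}" and D: "1 \<le> D" and ef: "e \<le> f"
    and left: "b + j - D < e" and right: "f < a + j + D"
begin

text \<open>The \<open>min\<close> keeps the localising interval nonempty even when \<open>S\<close>
  has no site on this side; the \<open>max\<close> in the mirror statement does the same.\<close>

lemma far_left_mem:
  "y \<in> M {a..b} \<Longrightarrow> field r {i \<in> S. i \<le> j - D} y \<in> M {min (a + lo) (b + j - D)..b + j - D}"
  by (rule field_mem[OF ab]) (auto simp: S)

lemma far_right_mem: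
  "y \<in> M {a..b} \<Longrightarrow> field r {i \<in> S. j + D \<le> i} y \<in> M {a + j + D..max (b + hi) (a + j + D)}"
  by (rule field_mem[OF ab]) (auto simp: S)

lemma far_commute:
  assumes y: "y \<in> M {a..b}" and z: "z \<in> M {e..f}"
  shows "field r {i \<in> S. D \<le> \<bar>i - j\<bar>} y * z = z * field r {i \<in> S. D \<le> \<bar>i - j\<bar>} y"
proof -
  have "field r {i \<in> S. i \<le> j - D} y * z = z * field r {i \<in> S. i \<le> j - D} y"
    by (rule commute_M[OF far_left_mem[OF y] z]) (use left ef in auto)
  moreover have "field r {i \<in> S. j + D \<le> i} y * z = z * field r {i \<in> S. j + D \<le> i} y"
    by (rule commute_M[OF far_right_mem[OF y] z]) (use right ef in auto)
  ultimately show ?thesis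
    using field_far_split[OF D, of S r j y] by (simp add: S distrib_left distrib_right)
qed

text \<open>Left and right parts commute, so each exponential splits as
  \<open>exp p * exp q\<close>, and all left factors can be gathered in front of all right factors
  without changing the order within each side.\<close>

lemma far_factor:
  assumes "set ys \<subseteq> M {a..b}"
  shows "\<exists>l\<in>M {min (a + lo) (b + j - D)..b + j - D}. \<exists>u\<in>M {a + j + D..max (b + hi) (a + j + D)}.
    expprod r {i \<in> S. D \<le> \<bar>i - j\<bar>} ys = l * u"
  using assms
proof (induction ys)
  case Nil
  have "1 \<in> M {min (a + lo) (b + j - D)..b + j - D}" "1 \<in> M {a + j + D..max (b + hi) (a + j + D)}"
    by (auto intro!: M_1)
  then show ?case by (intro bexI[of _ 1]) auto
next
  case (Cons y ys)
  let ?L = "M {min (a + lo) (b + j - D)..b + j - D}"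
  let ?R = "M {a + j + D..max (b + hi) (a + j + D)}"
  obtain l u where lu: "l \<in> ?L" "u \<in> ?R" "expprod r {i \<in> S. D \<le> \<bar>i - j\<bar>} ys = l * u"
    using Cons by auto
  define p where "p = field r {i \<in> S. i \<le> j - D} y"
  define q where "q = field r {i \<in> S. j + D \<le> i} y"
  have p: "p \<in> ?L" "exp p \<in> ?L" and q: "q \<in> ?R" "exp q \<in> ?R"
    using Cons.prems far_left_mem far_right_mem by (auto simp: p_def q_def intro!: M_exp)
  have com: "x * x' = x' * x" if "x \<in> ?L" "x' \<in> ?R" for x x'
    by (rule commute_M[OF that]) (use left right ef in auto)
  have "exp (field r {i \<in> S. D \<le> \<bar>i - j\<bar>} y) = exp p * exp q"
    using field_far_split[OF D, of S r j y] exp_add_commuting[OF com[OF p(1) q(1)]]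
    by (simp add: S p_def q_def)
  then have "expprod r {i \<in> S. D \<le> \<bar>i - j\<bar>} (y # ys) = exp p * (exp q * l) * u"
    by (simp add: lu(3) mult.assoc)
  also have "\<dots> = (exp p * l) * (exp q * u)"
    by (simp add: com[OF lu(1) q(2), symmetric] mult.assoc)
  finally show ?case
    using p q lu by (intro bexI[of _ "exp p * l"] bexI[of _ "exp q * u"]) (auto intro!: M_mult)
qed

text \<open>The support of \<open>z\<close> lies in the gap between those of \<open>l\<close> and
  \<open>u\<close>. Multiplicativity of \<open>chi\<close> concerns two intervals at a time, so it
  is applied to \<open>l * z\<close> against \<open>u\<close>, then to \<open>l\<close> against
  \<open>z\<close>, and finally backwards to recombine \<open>l * u\<close>.\<close>

lemma far_decouple:
  assumes ys: "set ys \<subseteq> M {a..b}" and z: "z \<in> M {e..f}"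
  shows "chi (expprod r {i \<in> S. D \<le> \<bar>i - j\<bar>} ys * z) = chi (expprod r {i \<in> S. D \<le> \<bar>i - j\<bar>} ys) * chi z"
proof -
  define c where "c = min (a + lo) (b + j - D)"
  define d where "d = max (b + hi) (a + j + D)"
  have cd: "c \<le> b + j - D" "a + j + D \<le> d" by (auto simp: c_def d_def)
  obtain l u where l: "l \<in> M {c..b + j - D}" and u: "u \<in> M {a + j + D..d}"
    and eq: "expprod r {i \<in> S. D \<le> \<bar>i - j\<bar>} ys = l * u"
    using far_factor[OF ys] unfolding c_def d_def by blast
  have lz: "l * z \<in> M {c..f}"
    using l z cd left ef by (intro M_mult) (auto intro: mono_M[of c "b + j - D"] mono_M[of e f])
  have "l * u * z = (l * z) * u"
    using commute_M[OF z u] right ef cd by (simp add: mult.assoc)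
  then have "chi (l * u * z) = chi (l * z) * chi u"
    using chi_mult[OF lz u] right left ef cd by simp
  also have "chi (l * z) = chi l * chi z"
    using chi_mult[OF l z] left ef cd by simp
  finally have "chi (l * u * z) = chi l * chi u * chi z" by simp
  also have "chi l * chi u = chi (l * u)"
    using chi_mult[OF l u] left right ef cd by simp
  finally show ?thesis by (simp add: eq)
qed

end

end

section \<open>The approximate differential equation\<close>

context lattice_state
begin

section \<open>Correlations of finite range and their sums\<close>

definition corr :: "'a \<Rightarrow> 'a \<Rightarrow> int \<Rightarrow> complex" where
  "corr x y m = chi (x * \<gamma> m y) - chi x * chi y"

lemma corr_eq_0:
  assumes "a \<le> b" "x \<in> M {a..b}" "y \<in> M {a..b}" "b - a < \<bar>m\<bar>"
  shows "corr x y m = 0"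
proof -
  have "chi (x * \<gamma> m y) = chi x * chi (\<gamma> m y)"
    by (rule chi_mult[OF assms(2) trans_mem[OF assms(3,1)]]) (use assms in auto)
  then show ?thesis by (simp add: corr_def chi_translate)
qed

lemma corr_nonzero:
  "\<lbrakk>corr x y m \<noteq> 0; a \<le> b; x \<in> M {a..b}; y \<in> M {a..b}\<rbrakk> \<Longrightarrow> \<bar>m\<bar> \<le> b - a"
  using corr_eq_0[of a b x y m] by (cases "b - a < \<bar>m\<bar>") auto

text \<open>A shift by more than \<open>b - a\<close> makes the supports disjoint, where the product
  property removes the correlation.\<close>

lemma corr_sum_eq:
  assumes "a \<le> b" "x \<in> M {a..b}" "y \<in> M {a..b}"
  shows "corr_sum \<gamma> chi x y = (\<Sum>m\<in>{a - b..b - a}. corr x y m)"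
proof -
  have "corr_sum \<gamma> chi x y = infsum (corr x y) {a - b..b - a}"
    unfolding corr_sum_def
    by (rule infsum_cong_neutral) (use corr_eq_0[OF assms] in \<open>auto simp: corr_def\<close>)
  then show ?thesis by simp
qed

lemma corr_add_left: "corr (x + x') y m = corr x y m + corr x' y m"
  and corr_scaleR_left: "corr (t *\<^sub>R x) y m = of_real t * corr x y m"
  by (simp_all add: corr_def distrib_left distrib_right chi_add trans_add chi_scaleR right_diff_distrib)

lemma corr_bound: "cmod (corr x y m) \<le> 4 * norm x * norm y"
proof -
  have "corr x y m = chi (site 0 x * site m y)"
    by (simp add: corr_def chi_site_site)
  also have "cmod \<dots> \<le> norm (site 0 x) * norm (site m y)"
    by (rule order.trans[OF chi_bound norm_mult_ineq])
  also have "\<dots> \<le> (2 * norm x) * (2 * norm y)"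
    by (intro mult_mono norm_site) auto
  finally show ?thesis by simp
qed

lemma corr_adj:
  assumes "adj x = x" "adj y = y"
  shows "corr y x m = cnj (corr x y (- m))"
proof -
  have "cnj (chi (x * \<gamma> (- m) y)) = chi (\<gamma> (- m) y * x)"
    by (simp add: assms adj_mult flip: chi_adj trans_adj)
  also have "\<dots> = chi (\<gamma> m (\<gamma> (- m) y * x))"
    by (simp add: chi_translate)
  also have "\<dots> = chi (y * \<gamma> m x)"
    by (simp add: trans_mult trans_trans trans_0)
  finally have "chi (y * \<gamma> m x) = cnj (chi (x * \<gamma> (- m) y))" ..
  moreover have "cnj (chi x) = chi x" "cnj (chi y) = chi y"
    using assms by (simp_all flip: chi_adj)
  ultimately show ?thesis
    by (simp add: corr_def)
qed

text \<open>For a site \<open>j\<close> deep inside \<open>S\<close> the inner sum is the complete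
  correlation sum. The discrepancy comes from the sites near the two ends, hence the bound does not
  grow with \<open>S\<close>.\<close>

lemma corr_double_sum:
  assumes ab: "a \<le> b" and x: "x \<in> M {a..b}" and y: "y \<in> M {a..b}" and S: "S = {lo..hi}"
  shows "cmod ((\<Sum>j\<in>S. \<Sum>i\<in>S. corr x y (j - i)) - card S * corr_sum \<gamma> chi x y)
     \<le> 8 * (real_of_int (b - a + 1))\<^sup>2 * norm x * norm y"
proof -
  define B where "B = {a - b..b - a}"
  define c where "c = 4 * norm x * norm y"
  have finS: "finite S" by (simp add: S)
  have inner: "(\<Sum>i\<in>S. corr x y (j - i)) = (\<Sum>m\<in>B. if j - m \<in> S then corr x y m else 0)" for j
  proof -
    have "(\<Sum>i\<in>S. corr x y (j - i)) = (\<Sum>i\<in>{i \<in> S. j - i \<in> B}. corr x y (j - i))"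
      by (rule sum.mono_neutral_right) (auto simp: S B_def dest!: corr_nonzero[OF _ ab x y])
    also have "\<dots> = (\<Sum>m\<in>{m \<in> B. j - m \<in> S}. corr x y m)"
      by (rule sum.reindex_bij_witness[where i="\<lambda>m. j - m" and j="\<lambda>i. j - i"]) auto
    also have "\<dots> = (\<Sum>m\<in>B. if j - m \<in> S then corr x y m else 0)"
      by (rule sum.inter_filter) (simp add: B_def)
    finally show ?thesis .
  qed
  have "(\<Sum>j\<in>S. \<Sum>i\<in>S. corr x y (j - i)) - card S * corr_sum \<gamma> chi x y
      = (\<Sum>j\<in>S. (\<Sum>m\<in>B. (if j - m \<in> S then corr x y m else 0) - corr x y m))"
    by (simp add: inner corr_sum_eq[OF ab x y] sum_subtractf flip: B_def)
  also have "\<dots> = (\<Sum>m\<in>B. \<Sum>j\<in>S. (if j - m \<in> S then 0 else - corr x y m))"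
    by (subst sum.swap) (auto intro!: sum.cong)
  also have "cmod \<dots> \<le> (\<Sum>m\<in>B. (b - a + 1) * c)"
  proof (rule sum_norm_le)
    fix m assume m: "m \<in> B"
    have "(\<Sum>j\<in>S. (if j - m \<in> S then 0 else - corr x y m)) = (\<Sum>j\<in>{j \<in> S. j - m \<notin> S}. - corr x y m)"
      by (rule sum.mono_neutral_cong_right) (auto simp: finS)
    also have "\<dots> = - (of_nat (card {j \<in> S. j - m \<notin> S}) * corr x y m)"
      by simp
    also have "cmod \<dots> \<le> (b - a + 1) * c"
      unfolding norm_minus_cancel norm_mult norm_of_nat
    proof (rule mult_mono)
      \<comment> \<open>For one sign of \<open>m\<close> the lost sites are the first
        \<open>m\<close> of \<open>S\<close>, for the other sign the last ones; the other interval
        in the union is empty. In either case there are at most \<open>b - a\<close> of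
        them.\<close>
      have "card {j \<in> S. j - m \<notin> S} \<le> card ({lo..<lo + m} \<union> {hi + m<..hi})"
        by (rule card_mono) (auto simp: S)
      also have "\<dots> \<le> card {lo..<lo + m} + card {hi + m<..hi}"
        by (rule card_Un_le)
      finally show "real (card {j \<in> S. j - m \<notin> S}) \<le> real_of_int (b - a + 1)"
        using m by (auto simp: B_def)
      show "cmod (corr x y m) \<le> c"
        unfolding c_def by (rule corr_bound)
    qed (use ab in auto)
    finally show "cmod (\<Sum>j\<in>S. (if j - m \<in> S then 0 else - corr x y m)) \<le> (b - a + 1) * c" .
  qed
  also have "\<dots> = card B * ((b - a + 1) * c)" by simp
  also have "\<dots> \<le> (2 * (b - a + 1)) * ((b - a + 1) * c)"
    using ab by (intro mult_right_mono) (auto simp: B_def c_def)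
  also have "\<dots> = 8 * (real_of_int (b - a + 1))\<^sup>2 * norm x * norm y"
    by (simp add: c_def power2_eq_square)
  finally show ?thesis .
qed

lemma norm_sum_list_le:
  fixes K :: real
  assumes "\<And>y. y \<in> set ys \<Longrightarrow> norm (y::'a) \<le> K"
  shows "norm (sum_list ys) \<le> length ys * K"
  using assms
proof (induction ys)
  case (Cons y ys)
  have "norm (y + sum_list ys) \<le> K + length ys * K"
    by (intro norm_triangle_mono Cons.IH) (use Cons.prems in auto)
  then show ?case by (simp add: algebra_simps)
qed simp

lemma chi_diff_mult:
  assumes "norm (x - y) \<le> \<delta>" "norm z \<le> K" "0 \<le> K"
  shows "cmod (chi (x * z) - chi (y * z)) \<le> \<delta> * K"
proof -
  have "cmod (chi (x * z) - chi (y * z)) = cmod (chi ((x - y) * z))"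
    by (simp add: left_diff_distrib chi_diff)
  also have "\<dots> \<le> norm (x - y) * norm z"
    by (rule order.trans[OF chi_bound norm_mult_ineq])
  also have "\<dots> \<le> \<delta> * K"
    using assms by (intro mult_mono) (auto intro: order.trans[OF norm_ge_zero])
  finally show ?thesis .
qed

text \<open>The error is of order \<open>r\<^sup>2\<close>. For
  \<open>r = 1 / sqrt (card S)\<close>, summing it over \<open>card S\<close> sites and multiplying
  by the outer factor \<open>r\<close> still leaves a quantity of order \<open>r\<close>.\<close>

lemma site_decouple:
  fixes a b L :: int and r K :: real
  assumes ab: "a \<le> b" and L_def: "L = b - a + 1" and S: "S = {lo..hi}" and r: "0 \<le> r" and K: "0 \<le> K"
    and ys: "set ys \<subseteq> M {a..b}" "\<And>y. y \<in> set ys \<Longrightarrow> adj y = y" "\<And>y. y \<in> set ys \<Longrightarrow> norm y \<le> K"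
    and z: "z \<in> M {a..b}" "norm z \<le> K"
  shows "cmod (chi (expprod r S ys * site j z) -
      chi (expprod r S ys) * chi (field r {i \<in> S. \<bar>i - j\<bar> < L} (sum_list ys) * site j z))
     \<le> 10 * (length ys)\<^sup>2 * K * (8 * r * L * K)\<^sup>2"
proof -
  define k where "k = real (length ys)"
  define \<rho> where "\<rho> = 8 * r * L * K"
  define N where "N = {i \<in> S. \<bar>i - j\<bar> < L}"
  define N2 where "N2 = {i \<in> S. L \<le> \<bar>i - j\<bar> \<and> \<bar>i - j\<bar> < 2 * L}"
  define F where "F = {i \<in> S. L \<le> \<bar>i - j\<bar>}"
  define F2 where "F2 = {i \<in> S. 2 * L \<le> \<bar>i - j\<bar>}"
  define E where "E = expprod r S ys"
  define V where "V = expprod r F ys"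
  define W where "W = expprod r F2 ys"
  define R where "R = field r N (sum_list ys)"
  define s where "s = site j z"
  \<comment> \<open>\<open>V\<close> is independent of \<open>s\<close>; \<open>R\<close> is the first-order effect of the near sites, and \<open>W\<close> is
    independent of \<open>R * s\<close>. The near sites \<open>N\<close> fail to commute with \<open>F\<close> only through \<open>N2\<close>.\<close>
  have L: "1 \<le> L" using ab by (simp add: L_def)
  have fin: "finite S" by (simp add: S)
  have \<rho>0: "0 \<le> \<rho>" using r K L by (simp add: \<rho>_def)
  have s: "norm s \<le> 2 * K" "s \<in> M {a + j..b + j}"
    using norm_site[of j z] z site_mem[OF ab z(1)] by (auto simp: s_def)
  \<comment> \<open>The window has fewer than \<open>4 * L\<close> sites and each centred translate
    has norm at most \<open>2 * K\<close>, which explains the 8 in \<open>\<rho>\<close>.\<close>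
  have small: "norm (field r A y) \<le> \<rho>" if "A \<subseteq> {j - 2 * L<..<j + 2 * L}" "norm y \<le> K" for A y
  proof -
    have "card A \<le> card {j - 2 * L<..<j + 2 * L}" using that by (intro card_mono) auto
    then have cA: "real (card A) \<le> 4 * L" using L by simp
    have "norm (field r A y) \<le> r * (card A * (2 * norm y))" using norm_field[of r A y] r by simp
    also have "\<dots> \<le> r * (4 * L * (2 * K))"
      using cA that(2) r K L by (intro mult_left_mono mult_mono) auto
    finally show ?thesis by (simp add: \<rho>_def)
  qed
  have NN: "N \<subseteq> {j - 2 * L<..<j + 2 * L}" "N2 \<subseteq> {j - 2 * L<..<j + 2 * L}"
    "N \<union> N2 \<subseteq> {j - 2 * L<..<j + 2 * L}"
    using L by (auto simp: N_def N2_def)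
  have SF: "field r S y = field r F y + field r N y" for y
  proof -
    have "F \<union> N = S" by (auto simp: F_def N_def)
    moreover have "field r (F \<union> N) y = field r F y + field r N y"
      by (rule field_Un) (use fin in \<open>auto simp: F_def N_def\<close>)
    ultimately show ?thesis by simp
  qed
  have FF: "field r F y = field r F2 y + field r N2 y" for y
  proof -
    have "F2 \<union> N2 = F" using L by (auto simp: F_def F2_def N2_def)
    moreover have "field r (F2 \<union> N2) y = field r F2 y + field r N2 y"
      by (rule field_Un) (use fin in \<open>auto simp: F_def F2_def N2_def\<close>)
    ultimately show ?thesis by simp
  qed
  have SF2: "field r S y = field r F2 y + field r (N \<union> N2) y" for y
  proof -
    have "F2 \<union> (N \<union> N2) = S" using L by (auto simp: N_def F2_def N2_def)
    moreover have "field r (F2 \<union> (N \<union> N2)) y = field r F2 y + field r (N \<union> N2) y"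
      by (rule field_Un) (use fin in \<open>auto simp: N_def F2_def N2_def\<close>)
    ultimately show ?thesis by simp
  qed
  have Nmem: "field r N y \<in> M {a + j - L + 1..b + j + L - 1}" if "y \<in> M {a..b}" for y
    by (rule field_mem[OF ab]) (use that ab L in \<open>auto simp: N_def\<close>)
  have comm: "norm (field r F y * field r N y' - field r N y' * field r F y) \<le> 2 * \<rho>\<^sup>2"
    if "y \<in> set ys" "y' \<in> set ys" for y y'
  proof -
    have "field r F2 y * field r N y' = field r N y' * field r F2 y"
      unfolding F2_def
      by (rule far_commute[OF ab S _ _ _ _ _ Nmem]) (use that ys L in \<open>auto simp: L_def\<close>)
    then have "field r F y * field r N y' - field r N y' * field r F y
        = field r N2 y * field r N y' - field r N y' * field r N2 y"
      by (simp add: FF algebra_simps)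
    also have "norm \<dots> \<le> norm (field r N2 y) * norm (field r N y') + norm (field r N y') * norm (field r N2 y)"
      by (intro order.trans[OF norm_triangle_ineq4] add_mono norm_mult_ineq)
    also have "\<dots> \<le> \<rho> * \<rho> + \<rho> * \<rho>"
      using small NN ys that \<rho>0 by (intro add_mono mult_mono) auto
    finally show ?thesis by (simp add: power2_eq_square)
  qed
  have EV: "norm (E - V * (1 + R)) \<le> k\<^sup>2 * (\<rho>\<^sup>2 + 2 * \<rho>\<^sup>2)"
    unfolding E_def V_def R_def SF field_sum_list k_def
    using ys small NN comm
    by (intro prod_list_exp_skew_first_order) (auto simp: adj_field)
  have VW: "norm (V - W) \<le> k * \<rho>"
    unfolding V_def W_def FF k_def
    by (rule prod_list_exp_skew_perturb[where A="field r F2" and R="field r N2"])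
       (use ys small NN in \<open>auto simp: adj_field\<close>)
  have EW: "norm (E - W) \<le> k * \<rho>"
    unfolding E_def W_def SF2 k_def
    by (rule prod_list_exp_skew_perturb[where A="field r F2" and R="field r (N \<union> N2)"])
       (use ys small NN in \<open>auto simp: adj_field\<close>)
  have R: "norm R \<le> k * \<rho>"
  proof -
    have "norm (sum_list (map (field r N) ys)) \<le> length (map (field r N) ys) * \<rho>"
      by (rule norm_sum_list_le) (use small NN ys in auto)
    then show ?thesis by (simp add: R_def field_sum_list k_def)
  qed
  have Rs: "norm (R * s) \<le> k * \<rho> * (2 * K)"
    by (intro order.trans[OF norm_mult_ineq] mult_mono R s) (auto simp: k_def \<rho>0)
  have Vs: "chi (V * s) = 0"
  proof -
    have "chi (V * s) = chi V * chi s"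
      unfolding V_def F_def
      by (rule far_decouple[OF ab S _ _ _ _ ys(1) s(2)]) (use ab L in \<open>auto simp: L_def\<close>)
    then show ?thesis by (simp add: s_def chi_site)
  qed
  \<comment> \<open>The product \<open>R * s\<close> occupies a wider interval than
    \<open>s\<close>, so the excluded radius must be \<open>2 * L\<close> for the remaining sites to
    be independent of it.\<close>
  have Ws: "chi (W * (R * s)) = chi W * chi (R * s)"
    unfolding W_def F2_def
  proof (rule far_decouple[OF ab S _ _ _ _ ys(1)])
    show "R * s \<in> M {a + j - L + 1..b + j + L - 1}"
      using ab L s(2) Nmem[OF M_sum_list[OF ab ys(1)]]
      by (intro M_mult) (auto simp: R_def intro: mono_M[of "a + j" "b + j"])
  qed (use ab L in \<open>auto simp: L_def\<close>)
  have e1: "cmod (chi (E * s) - chi (V * (1 + R) * s)) \<le> k\<^sup>2 * (\<rho>\<^sup>2 + 2 * \<rho>\<^sup>2) * (2 * K)"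
    using EV s K by (intro chi_diff_mult) auto
  have e2: "cmod (chi (V * (R * s)) - chi (W * (R * s))) \<le> k * \<rho> * (k * \<rho> * (2 * K))"
    using VW Rs K \<rho>0 by (intro chi_diff_mult) (auto simp: k_def)
  have e3: "cmod (chi W * chi (R * s) - chi E * chi (R * s)) \<le> k * \<rho> * (k * \<rho> * (2 * K))"
  proof -
    have "cmod (chi W * chi (R * s) - chi E * chi (R * s)) = cmod (chi (E - W)) * cmod (chi (R * s))"
      by (simp add: chi_diff norm_mult norm_minus_commute flip: left_diff_distrib)
    also have "\<dots> \<le> k * \<rho> * (k * \<rho> * (2 * K))"
      using EW Rs \<rho>0 by (intro mult_mono order.trans[OF chi_bound]) (auto simp: k_def)
    finally show ?thesis .
  qed
  have "chi (V * (1 + R) * s) = chi (V * (R * s))"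
    using Vs by (simp add: distrib_left distrib_right chi_add mult.assoc)
  \<comment> \<open>Expand \<open>E\<close> around \<open>V\<close>, thin \<open>V\<close> out to
    \<open>W\<close> so that \<open>chi\<close> factorises, then restore \<open>E\<close>. The three
    costs contribute 6, 2 and 2 to the constant 10.\<close>
  then have "chi (E * s) - chi E * chi (R * s) = (chi (E * s) - chi (V * (1 + R) * s)) +
     ((chi (V * (R * s)) - chi (W * (R * s))) + (chi W * chi (R * s) - chi E * chi (R * s)))"
    by (simp add: Ws)
  also have "cmod \<dots> \<le> k\<^sup>2 * (\<rho>\<^sup>2 + 2 * \<rho>\<^sup>2) * (2 * K) + (k * \<rho> * (k * \<rho> * (2 * K)) + k * \<rho> * (k * \<rho> * (2 * K)))"
    by (intro norm_triangle_mono e1 e2 e3)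
  also have "\<dots> = 10 * k\<^sup>2 * K * \<rho>\<^sup>2"
    by (simp add: algebra_simps power2_eq_square)
  finally show ?thesis
    by (simp add: E_def R_def s_def k_def \<rho>_def N_def)
qed

text \<open>Sites at distance at least \<open>b - a + 1\<close> carry no correlation, so the sum
  over near sites may be extended to all of \<open>S\<close>.\<close>

lemma near_corr:
  assumes ab: "a \<le> b" and S: "S = {lo..hi}" and y: "y \<in> M {a..b}" and z: "z \<in> M {a..b}"
  shows "chi (field r {i \<in> S. \<bar>i - j\<bar> < b - a + 1} y * site j z) = \<i> * r * (\<Sum>i\<in>S. corr y z (j - i))"
proof -
  have "chi (field r {i \<in> S. \<bar>i - j\<bar> < b - a + 1} y * site j z)
     = \<i> * r * (\<Sum>i\<in>{i \<in> S. \<bar>i - j\<bar> < b - a + 1}. corr y z (j - i))"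
    by (simp add: field_def mult.assoc chi_scaleR chi_ci sum_distrib_right chi_sum chi_site_site corr_def)
  also have "(\<Sum>i\<in>{i \<in> S. \<bar>i - j\<bar> < b - a + 1}. corr y z (j - i)) = (\<Sum>i\<in>S. corr y z (j - i))"
    by (rule sum.mono_neutral_left) (auto simp: S dest!: corr_nonzero[OF _ ab y z])
  finally show ?thesis .
qed

text \<open>An approximate Gaussian integration by parts: inserting one further fluctuation acts, up
  to order \<open>r\<close>, as multiplication by minus its covariance with the sum of the
  exponents. It sums the single-site estimate over \<open>S\<close>.\<close>

lemma field_stein:
  fixes a b :: int and r K :: real
  assumes ab: "a \<le> b" and S: "S = {lo..hi}" "lo \<le> hi" and K: "0 \<le> K" and r: "r = 1 / sqrt (card S)"
    and ys: "set ys \<subseteq> M {a..b}" "\<And>y. y \<in> set ys \<Longrightarrow> adj y = y" "\<And>y. y \<in> set ys \<Longrightarrow> norm y \<le> K"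
    and z: "z \<in> M {a..b}" "norm z \<le> K"
  shows "cmod (chi (expprod r S ys * field r S z) + corr_sum \<gamma> chi (sum_list ys) z * chi (expprod r S ys))
     \<le> (640 * (length ys)\<^sup>2 * K ^ 3 * (real_of_int (b - a + 1))\<^sup>2 + 8 * (real_of_int (b - a + 1))\<^sup>2 * length ys * K\<^sup>2) * r"
proof -
  define k where "k = real (length ys)"
  define L where "L = real_of_int (b - a + 1)"
  define E where "E = expprod r S ys"
  define Y where "Y = sum_list ys"
  define C where "C = corr_sum \<gamma> chi Y z"
  define D where "D = (\<Sum>j\<in>S. \<Sum>i\<in>S. corr Y z (j - i))"
  define \<delta> where "\<delta> = 10 * k\<^sup>2 * K * (8 * r * L * K)\<^sup>2"
  have cS: "1 \<le> real (card S)" using S by simp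
  have r0: "0 \<le> r" "r \<le> 1" and rr: "r * r * card S = 1"
    using cS by (auto simp: r)
  have Y: "Y \<in> M {a..b}" "norm Y \<le> k * K"
    unfolding Y_def k_def using M_sum_list[OF ab ys(1)] norm_sum_list_le[of ys K] ys by auto
  have E1: "cmod (chi E) \<le> 1"
    using chi_bound[of E] norm_expprod[of ys r S] ys(2) by (simp add: E_def)
  have site: "cmod (chi (E * site j z) - chi E * (\<i> * r * (\<Sum>i\<in>S. corr Y z (j - i)))) \<le> \<delta>" for j
    using site_decouple[OF ab refl S(1) r0(1) K ys z, of j] near_corr[OF ab S(1) Y(1) z(1), of r j]
    by (simp add: E_def Y_def k_def L_def \<delta>_def)
  have A: "cmod ((\<Sum>j\<in>S. chi (E * site j z)) - chi E * (\<i> * r * D)) \<le> card S * \<delta>"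
  proof -
    have "(\<Sum>j\<in>S. chi (E * site j z)) - chi E * (\<i> * r * D)
        = (\<Sum>j\<in>S. chi (E * site j z) - chi E * (\<i> * r * (\<Sum>i\<in>S. corr Y z (j - i))))"
      by (simp add: D_def sum_subtractf sum_distrib_left)
    also have "cmod \<dots> \<le> card S * \<delta>"
      by (rule sum_norm_bound) (rule site)
    finally show ?thesis .
  qed
  have B: "cmod (D - card S * C) \<le> 8 * L\<^sup>2 * norm Y * norm z"
    using corr_double_sum[OF ab Y(1) z(1) S(1)] by (simp add: D_def C_def L_def)
  have eqE: "chi (E * field r S z) = \<i> * r * (\<Sum>j\<in>S. chi (E * site j z))"
    by (simp add: field_def ci_left_commute chi_scaleR chi_ci sum_distrib_left chi_sum mult_ac)
  have "of_real r * of_real r * of_nat (card S) = (1::complex)"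
    using arg_cong[OF rr, of complex_of_real] by simp
  \<comment> \<open>The normalisation \<open>r * r * card S = 1\<close> lets
    \<open>C * chi E\<close> be compared with the double sum \<open>D\<close>; the sign comes from
    the two factors \<open>\<i>\<close>, one in the last field and one in the expansion.\<close>
  then have "C * chi E = of_real r * of_real r * of_nat (card S) * (C * chi E)"
    by simp
  then have "chi (E * field r S z) + C * chi E
     = \<i> * r * ((\<Sum>j\<in>S. chi (E * site j z)) - chi E * (\<i> * r * D)) - r * r * chi E * (D - card S * C)"
    unfolding eqE by (simp add: algebra_simps)
  also have "cmod \<dots> \<le> r * (card S * \<delta>) + r * r * 1 * (8 * L\<^sup>2 * norm Y * norm z)"
  proof (intro order.trans[OF norm_triangle_ineq4] add_mono)
    show "cmod (\<i> * r * ((\<Sum>j\<in>S. chi (E * site j z)) - chi E * (\<i> * r * D))) \<le> r * (card S * \<delta>)"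
      using A r0 by (simp add: norm_mult mult_left_mono)
    have "cmod (r * r * chi E * (D - card S * C)) = r * r * cmod (chi E) * cmod (D - card S * C)"
      using r0 by (simp add: norm_mult)
    also have "\<dots> \<le> r * r * 1 * (8 * L\<^sup>2 * norm Y * norm z)"
      using r0 by (intro mult_mono[OF mult_left_mono[OF E1] B]) auto
    finally show "cmod (r * r * chi E * (D - card S * C)) \<le> r * r * 1 * (8 * L\<^sup>2 * norm Y * norm z)" .
  qed
  also have "r * (card S * \<delta>) = 640 * k\<^sup>2 * K ^ 3 * L\<^sup>2 * r * (r * r * card S)"
    by (simp add: \<delta>_def power2_eq_square power3_eq_cube)
  also have "\<dots> = 640 * k\<^sup>2 * K ^ 3 * L\<^sup>2 * r"
    by (simp add: rr)
  \<comment> \<open>Since \<open>r\<close> is at most 1, the boundary error of order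
    \<open>r * r\<close> is absorbed into order \<open>r\<close>.\<close>
  also have "r * r * 1 * (8 * L\<^sup>2 * norm Y * norm z) \<le> 1 * r * 1 * (8 * L\<^sup>2 * (k * K) * K)"
    using r0 Y z K by (intro mult_mono) (auto simp: k_def)
  finally show ?thesis
    by (simp add: E_def C_def Y_def k_def L_def power2_eq_square algebra_simps)
qed

end

section \<open>The limit and the quasi-free state\<close>

context lattice_state
begin

section \<open>Local self-adjoint elements and the hermitian correlation form\<close>

lemma local_sa_adj: "x \<in> local_sa M \<Longrightarrow> adj x = x"
  by (simp add: local_sa_def self_adjoint_def)

lemma local_sa_common_interval:
  assumes "finite X" "X \<subseteq> local_sa M"
  shows "\<exists>a b. a \<le> b \<and> X \<subseteq> M {a..b}"
  using assms
proof (induction X)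
  case empty
  show ?case by auto
next
  case (insert x X)
  then obtain a b where ab: "a \<le> b" "X \<subseteq> M {a..b}" by auto
  obtain c d where cd: "c \<le> d" "x \<in> M {c..d}"
    using insert.prems by (auto simp: local_sa_def local_union_def fin_intervals_def)
  have "y \<in> M {min a c..max b d}" if "y \<in> insert x X" for y
    using that ab cd by (auto intro: mono_M[OF ab(1)] mono_M[OF cd(1)])
  moreover have "min a c \<le> max b d" using ab by linarith
  ultimately show ?case by blast
qed

lemma corr_sum_add_left:
  assumes "x \<in> local_sa M" "x' \<in> local_sa M" "y \<in> local_sa M"
  shows "corr_sum \<gamma> chi (x + x') y = corr_sum \<gamma> chi x y + corr_sum \<gamma> chi x' y"
proof -
  obtain a b where ab: "a \<le> b" "{x, x', y} \<subseteq> M {a..b}"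
    using local_sa_common_interval[of "{x, x', y}"] assms by auto
  then show ?thesis
    by (simp add: corr_sum_eq[OF ab(1)] M_add corr_add_left sum.distrib)
qed

text \<open>Invariance under translation turns the adjoint into the reflection \<open>m\<close> to
  \<open>- m\<close>, which preserves the range of summation. Thus \<open>s_chi\<close> is symmetric
  and \<open>sigma_chi\<close> antisymmetric.\<close>

lemma corr_sum_cnj:
  assumes "x \<in> local_sa M" "y \<in> local_sa M"
  shows "corr_sum \<gamma> chi y x = cnj (corr_sum \<gamma> chi x y)"
proof -
  obtain a b where ab: "a \<le> b" "{x, y} \<subseteq> M {a..b}"
    using local_sa_common_interval[of "{x, y}"] assms by auto
  have "(\<Sum>m\<in>{a - b..b - a}. corr y x m) = (\<Sum>m\<in>{a - b..b - a}. cnj (corr x y m))"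
    by (rule sum.reindex_bij_witness[where i=uminus and j=uminus]) (use corr_adj[of x y] assms in \<open>auto simp: local_sa_adj\<close>)
  then show ?thesis
    using ab by (simp add: corr_sum_eq[OF ab(1)] cnj_sum)
qed

lemma local_sa_add:
  assumes "x \<in> local_sa M" "y \<in> local_sa M"
  shows "x + y \<in> local_sa M"
proof -
  obtain a b where ab: "a \<le> b" "{x, y} \<subseteq> M {a..b}"
    using local_sa_common_interval[of "{x, y}"] assms by auto
  then have "x + y \<in> M {a..b}" by (simp add: M_add)
  then show ?thesis
    using ab(1) assms
    by (auto simp: local_sa_def local_union_def self_adjoint_def adj_add intro!: bexI[of _ "{a..b}"])
qed

lemma local_sa_0: "0 \<in> local_sa M"
proof -
  have "0 \<in> M {0..0}" "{0..0::int} \<in> fin_intervals"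
    by (rule M_0, simp) (rule fin_intervals_atLeastAtMost, simp)
  then show ?thesis unfolding local_sa_def local_union_def self_adjoint_def by auto
qed

lemma local_sa_sum_list: "set xs \<subseteq> local_sa M \<Longrightarrow> sum_list xs \<in> local_sa M"
  by (induction xs) (simp_all add: local_sa_0 local_sa_add)

text \<open>Scaling the appended element by \<open>t\<close> interpolates between the shorter
  product at \<open>t = 0\<close> and the longer one at \<open>t = 1\<close>. The interpolation
  solves a linear equation up to an error of order \<open>r n\<close> uniform in \<open>t\<close>,
  so an integrating factor gives the ratio of the limits.\<close>

lemma fluct_limit_snoc:
  fixes \<Lambda> :: "nat \<Rightarrow> int set"
  assumes \<Lambda>: "\<And>n. \<Lambda> n \<in> fin_intervals" "filterlim (\<lambda>n. real (card (\<Lambda> n))) at_top sequentially"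
    and xs: "set (xs @ [x]) \<subseteq> local_sa M"
    and lim: "(\<lambda>n. chi (prod_list (map (\<lambda>x. exp (ci * fluct \<gamma> chi (\<Lambda> n) x)) xs))) \<longlonglongrightarrow> \<omega>"
  shows "(\<lambda>n. chi (prod_list (map (\<lambda>x. exp (ci * fluct \<gamma> chi (\<Lambda> n) x)) (xs @ [x]))))
    \<longlonglongrightarrow> \<omega> * exp (- (corr_sum \<gamma> chi (sum_list xs) x + corr_sum \<gamma> chi x x / 2))"
proof -
  obtain a b where ab: "a \<le> b" and xs_M: "set (xs @ [x]) \<subseteq> M {a..b}"
    using local_sa_common_interval[OF _ xs] by auto
  have xs_adj: "adj y = y" if "y \<in> set (xs @ [x])" for y
    using that xs local_sa_adj by blast
  define K where "K = Max (norm ` set (xs @ [x]))"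
  have K: "norm y \<le> K" if "y \<in> set (xs @ [x])" for y
    unfolding K_def using that by (intro Max_ge) auto
  have K0: "0 \<le> K" using order.trans[OF norm_ge_zero K[of x]] by simp
  define c1 where "c1 = corr_sum \<gamma> chi (sum_list xs) x"
  define c2 where "c2 = corr_sum \<gamma> chi x x"
  define r where "r n = 1 / sqrt (card (\<Lambda> n))" for n
  define X where "X n = field (r n) (\<Lambda> n) x" for n
  define P where "P n = expprod (r n) (\<Lambda> n) xs" for n
  define f where "f n t = chi (P n * exp (t *\<^sub>R X n))" for n t
  define k where "k = real (length xs + 1)"
  define C where "C = 640 * k\<^sup>2 * K ^ 3 * (real_of_int (b - a + 1))\<^sup>2 + 8 * (real_of_int (b - a + 1))\<^sup>2 * k * K\<^sup>2"
  \<comment> \<open>The integrating factor of the equation \<open>f' = - (c1 + t * c2) * f\<close>;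
    the product of \<open>f n\<close> and \<open>e\<close> is constant up to the error.\<close>
  define e where "e t = exp (c1 * of_real t + c2 * of_real (t\<^sup>2) / 2)" for t :: real
  have C0: "0 \<le> C" using K0 by (simp add: C_def k_def)
  have r_lim: "r \<longlonglongrightarrow> 0"
    unfolding r_def[abs_def]
    by (rule tendsto_divide_0[OF tendsto_const])
       (rule filterlim_at_top_imp_at_infinity[OF filterlim_compose[OF sqrt_at_top \<Lambda>(2)]])
  have corr_t: "corr_sum \<gamma> chi (sum_list (xs @ [t *\<^sub>R x])) x = c1 + of_real t * c2" for t
  proof -
    have sl: "sum_list xs \<in> M {a..b}" "x \<in> M {a..b}"
      using M_sum_list[OF ab] xs_M by auto
    then show ?thesis
      by (simp add: c1_def c2_def corr_sum_eq[OF ab] M_add M_scaleR ab corr_add_left corr_scaleR_left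
          sum.distrib sum_distrib_left)
  qed
  have ode: "cmod (chi (P n * exp (t *\<^sub>R X n) * X n) + (c1 + of_real t * c2) * f n t) \<le> C * r n"
    if t: "t \<in> {0..1}" for n t
  proof -
    obtain lo hi where S: "\<Lambda> n = {lo..hi}" "lo \<le> hi"
      using \<Lambda>(1)[of n] by (auto simp: fin_intervals_def)
    have eq: "expprod (r n) (\<Lambda> n) (xs @ [t *\<^sub>R x]) = P n * exp (t *\<^sub>R X n)"
      by (simp add: P_def X_def field_scaleR)
    \<comment> \<open>Restricting \<open>t\<close> to the unit interval keeps the same norm bound
      \<open>K\<close>, so a single constant \<open>C\<close> serves all \<open>t\<close> and
      \<open>n\<close>.\<close>
    have "norm (t *\<^sub>R x) \<le> K"
      using t K[of x] mult_right_mono[of t 1 "norm x"] by simp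
    then have "cmod (chi (expprod (r n) (\<Lambda> n) (xs @ [t *\<^sub>R x]) * field (r n) (\<Lambda> n) x)
        + corr_sum \<gamma> chi (sum_list (xs @ [t *\<^sub>R x])) x * chi (expprod (r n) (\<Lambda> n) (xs @ [t *\<^sub>R x])))
     \<le> (640 * (length (xs @ [t *\<^sub>R x]))\<^sup>2 * K ^ 3 * (real_of_int (b - a + 1))\<^sup>2
        + 8 * (real_of_int (b - a + 1))\<^sup>2 * length (xs @ [t *\<^sub>R x]) * K\<^sup>2) * r n"
      using xs_M xs_adj K ab
      by (intro field_stein[OF ab S K0 r_def]) (auto simp: adj_scaleR intro: M_scaleR)
    then show ?thesis
      unfolding eq corr_t f_def X_def[symmetric] C_def k_def by simp
  qed
  have key: "cmod (f n 1 * e 1 - f n 0 * e 0) \<le> C * r n * exp (cmod c1 + cmod c2)" for n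
  proof (rule deriv_bound_01[where f="\<lambda>t. f n t * e t"])
    fix t :: real assume t: "t \<in> {0..1}"
    have "((\<lambda>t. P n * exp (t *\<^sub>R X n)) has_vector_derivative P n * (exp (t *\<^sub>R X n) * X n)) (at t within {0..1})"
      by (rule has_vector_derivative_mult_right[OF exp_scaleR_has_vector_derivative_right])
    then have df: "(f n has_vector_derivative chi (P n * exp (t *\<^sub>R X n) * X n)) (at t within {0..1})"
      unfolding f_def[abs_def] mult.assoc
      by (rule bounded_linear.has_vector_derivative[OF bounded_linear_chi])
    \<comment> \<open>Differentiated as a function of a complex variable and then restricted to the
      real line.\<close>
    have "((\<lambda>z. exp (c1 * z + c2 * z\<^sup>2 / 2)) has_field_derivative
        (c1 + of_real t * c2) * e t) (at (of_real t))"
      by (auto intro!: derivative_eq_intros simp: e_def field_simps)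
    from has_vector_derivative_real_field[OF this]
    have de: "(e has_vector_derivative (c1 + of_real t * c2) * e t) (at t within {0..1})"
      by (simp add: e_def[abs_def])
    show "((\<lambda>t. f n t * e t) has_vector_derivative
       (f n t * ((c1 + of_real t * c2) * e t) + chi (P n * exp (t *\<^sub>R X n) * X n) * e t)) (at t within {0..1})"
      by (rule has_vector_derivative_mult[OF df de])
    have "cmod (e t) \<le> exp (cmod c1 + cmod c2)"
    proof -
      have "cmod (e t) = exp (Re (c1 * of_real t + c2 * of_real (t\<^sup>2) / 2))"
        by (simp add: e_def)
      also have "Re (c1 * of_real t + c2 * of_real (t\<^sup>2) / 2) \<le> cmod (c1 * of_real t + c2 * of_real (t\<^sup>2) / 2)"
        by (rule complex_Re_le_cmod)
      also have "\<dots> \<le> cmod c1 * \<bar>t\<bar> + cmod c2 * (t\<^sup>2 / 2)"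
        by (rule order.trans[OF norm_triangle_ineq]) (simp add: norm_mult norm_divide norm_power)
      also have "\<dots> \<le> cmod c1 * 1 + cmod c2 * 1"
        using t power_le_one[of t 2] by (intro add_mono mult_left_mono) auto
      finally show ?thesis by simp
    qed
    then have "cmod (chi (P n * exp (t *\<^sub>R X n) * X n) + (c1 + of_real t * c2) * f n t) * cmod (e t)
        \<le> C * r n * exp (cmod c1 + cmod c2)"
      using ode[OF t, of n] C0 by (intro mult_mono) (auto simp: r_def)
    then show "cmod (f n t * ((c1 + of_real t * c2) * e t) + chi (P n * exp (t *\<^sub>R X n) * X n) * e t)
        \<le> C * r n * exp (cmod c1 + cmod c2)"
      unfolding norm_mult[symmetric] by (simp add: algebra_simps)
  qed
  have "(\<lambda>n. C * r n * exp (cmod c1 + cmod c2)) \<longlonglongrightarrow> C * 0 * exp (cmod c1 + cmod c2)"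
    by (intro tendsto_intros r_lim)
  then have "(\<lambda>n. C * r n * exp (cmod c1 + cmod c2)) \<longlonglongrightarrow> 0" by simp
  then have "(\<lambda>n. f n 1 * e 1 - f n 0 * e 0) \<longlonglongrightarrow> 0"
    by (rule Lim_null_comparison[OF always_eventually[OF allI[OF key]]])
  moreover have "(\<lambda>n. f n 0 * e 0) \<longlonglongrightarrow> \<omega>"
    using lim by (simp add: f_def P_def e_def ci_fluct r_def)
  ultimately have "(\<lambda>n. (f n 1 * e 1 - f n 0 * e 0) + f n 0 * e 0) \<longlonglongrightarrow> 0 + \<omega>"
    by (rule tendsto_add)
  then have "(\<lambda>n. (f n 1 * e 1) * inverse (e 1)) \<longlonglongrightarrow> \<omega> * inverse (e 1)"
    by (intro tendsto_mult tendsto_const) simp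
  moreover have "(f n 1 * e 1) * inverse (e 1) = f n 1" for n
    by (simp add: e_def)
  ultimately have "(\<lambda>n. f n 1) \<longlonglongrightarrow> \<omega> * inverse (e 1)"
    by (simp only:)
  moreover have "inverse (e 1) = exp (- (c1 + c2 / 2))"
    by (simp add: e_def flip: exp_minus)
  moreover have "f n 1 = chi (prod_list (map (\<lambda>x. exp (ci * fluct \<gamma> chi (\<Lambda> n) x)) (xs @ [x])))" for n
    by (simp add: f_def P_def X_def ci_fluct r_def)
  ultimately show ?thesis
    by (simp add: c1_def c2_def)
qed

section \<open>The matching recursion for the Weyl operators\<close>

context
  fixes w :: "'a \<Rightarrow> 'w::cstar_algebra" and \<phi> :: "'w \<Rightarrow> complex"
  assumes weyl: "weyl_quasifree M \<gamma> chi w \<phi>"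
begin

lemma weyl_mult:
  assumes "x \<in> local_sa M" "y \<in> local_sa M"
  shows "w x * w y = scaleC (exp (\<i> * sigma_chi \<gamma> chi x y)) (w (x + y))"
  using weyl assms by (simp add: weyl_quasifree_def)

lemma weyl_state: "is_state \<phi>"
  using weyl by (simp add: weyl_quasifree_def)

lemma weyl_state_scaleC: "\<phi> (scaleC z u) = z * \<phi> u"
  using weyl_state unfolding is_state_def by blast

text \<open>The element \<open>w 0\<close> is a self-adjoint unitary that equals its own square,
  hence the unit.\<close>

lemma weyl_0: "w 0 = 1"
proof -
  have "adj (w 0) * w 0 = 1" "adj (w 0) = w 0" "\<phi> (w 0) = 1" "w 0 * w 0 = scaleC 1 (w 0)"
    using weyl local_sa_0 weyl_mult[of 0 0]
    by (auto simp: weyl_quasifree_def is_unitary_def s_chi_def sigma_chi_def corr_sum_def chi_scaleR[of 0 0, simplified])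
  then show ?thesis by simp
qed

text \<open>The scalar may stay implicit: it appears on both sides of the recursion for appending
  one factor.\<close>

lemma weyl_prod_list:
  assumes "set xs \<subseteq> local_sa M"
  shows "\<exists>z. prod_list (map w xs) = scaleC z (w (sum_list xs))"
  using assms
proof (induction xs rule: rev_induct)
  case Nil
  show ?case by (intro exI[of _ 1]) (simp add: weyl_0)
next
  case (snoc x xs)
  then obtain z where z: "prod_list (map w xs) = scaleC z (w (sum_list xs))" by auto
  show ?case
    using snoc.prems
    by (auto simp: z scaleC_mult weyl_mult local_sa_sum_list scaleC_scaleC)
qed

text \<open>The Weyl phase supplies the imaginary part of the correlation sum of \<open>s\<close>
  and \<open>x\<close>, and the cross term of the quadratic form supplies its real part; together
  they give the same factor as for the fluctuations.\<close>

lemma weyl_snoc: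
  assumes "set (xs @ [x]) \<subseteq> local_sa M"
  shows "\<phi> (prod_list (map w (xs @ [x])))
    = \<phi> (prod_list (map w xs)) * exp (- (corr_sum \<gamma> chi (sum_list xs) x + corr_sum \<gamma> chi x x / 2))"
proof -
  define s where "s = sum_list xs"
  have mem: "s \<in> local_sa M" "x \<in> local_sa M" "s + x \<in> local_sa M"
    using assms by (auto simp: s_def local_sa_sum_list local_sa_add)
  obtain z where z: "prod_list (map w xs) = scaleC z (w s)"
    using weyl_prod_list[of xs] assms by (auto simp: s_def)
  have quasifree: "\<phi> (w v) = exp (- of_real (Re (corr_sum \<gamma> chi v v)) / 2)" if "v \<in> local_sa M" for v
    using weyl that unfolding weyl_quasifree_def s_chi_def by (simp flip: exp_of_real)
  have real: "Im (corr_sum \<gamma> chi x x) = 0"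
    using corr_sum_cnj[OF mem(2,2)] by (simp add: complex_eq_iff)
  \<comment> \<open>Additivity in the second argument is obtained from the first by hermitian
    symmetry.\<close>
  have "corr_sum \<gamma> chi (s + x) (s + x) = cnj (corr_sum \<gamma> chi s (s + x)) + cnj (corr_sum \<gamma> chi x (s + x))"
    using corr_sum_add_left[OF mem(1,2,3)] corr_sum_cnj[OF mem(3,3)] by simp
  then have split: "Re (corr_sum \<gamma> chi (s + x) (s + x))
      = Re (corr_sum \<gamma> chi s s) + 2 * Re (corr_sum \<gamma> chi s x) + Re (corr_sum \<gamma> chi x x)"
    using corr_sum_add_left[OF mem(1,2,1)] corr_sum_add_left[OF mem(1,2,2)]
      corr_sum_cnj[OF mem(3,1)] corr_sum_cnj[OF mem(3,2)] corr_sum_cnj[OF mem(1,2)] by simp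
  have exponent: "\<i> * of_real (sigma_chi \<gamma> chi s x) + (- of_real (Re (corr_sum \<gamma> chi (s + x) (s + x))) / 2)
     = - of_real (Re (corr_sum \<gamma> chi s s)) / 2 + - (corr_sum \<gamma> chi s x + corr_sum \<gamma> chi x x / 2)"
    by (simp add: split real sigma_chi_def complex_eq_iff field_simps)
  have "\<phi> (prod_list (map w (xs @ [x])))
      = z * (exp (\<i> * of_real (sigma_chi \<gamma> chi s x)) * exp (- of_real (Re (corr_sum \<gamma> chi (s + x) (s + x))) / 2))"
    by (simp add: z scaleC_mult weyl_mult mem scaleC_scaleC weyl_state_scaleC quasifree)
  also have "\<dots> = z * exp (- of_real (Re (corr_sum \<gamma> chi s s)) / 2)
      * exp (- (corr_sum \<gamma> chi s x + corr_sum \<gamma> chi x x / 2))"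
    by (simp only: exp_add[symmetric] exponent mult.assoc)
  finally show ?thesis
    by (simp add: z weyl_state_scaleC quasifree mem flip: s_def)
qed

end

end

text \<open>An increasing family is a chain, so every finite window \<open>{1..int Z}\<close>
  already lies in one of its members and in all later ones. This provides the decay of the
  normalisation.\<close>

lemma card_exhaustion_at_top:
  fixes \<Lambda> :: "nat \<Rightarrow> int set"
  assumes "\<And>n. finite (\<Lambda> n)" "\<And>n. \<Lambda> n \<subseteq> \<Lambda> (Suc n)" "(\<Union>n. \<Lambda> n) = UNIV"
  shows "filterlim (\<lambda>n. real (card (\<Lambda> n))) at_top sequentially"
proof -
  have mono: "incseq \<Lambda>" by (rule incseq_SucI) (rule assms)
  have "filterlim (\<lambda>n. card (\<Lambda> n)) at_top sequentially"
    unfolding filterlim_at_top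
  proof
    fix Z :: nat
    have "\<Lambda> m \<subseteq> \<Lambda> n \<or> \<Lambda> n \<subseteq> \<Lambda> m" for m n
      using monoD[OF mono] nat_le_linear[of m n] by blast
    then have "subset.chain UNIV (range \<Lambda>)"
      by (auto simp: subset_chain_def)
    then have "\<exists>N. {1..int Z} \<subseteq> \<Lambda> N"
      by (rule finite_subset_Union_chain[rotated 3, of _ _ "{1..int Z}"]) (use assms(3) in auto)
    then obtain N where N: "{1..int Z} \<subseteq> \<Lambda> N" ..
    have "Z \<le> card (\<Lambda> n)" if "N \<le> n" for n
    proof -
      have "{1..int Z} \<subseteq> \<Lambda> n" using N monoD[OF mono that] by blast
      from card_mono[OF assms(1) this] show ?thesis by simp
    qed
    then show "\<forall>\<^sub>F n in sequentially. Z \<le> card (\<Lambda> n)"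
      unfolding eventually_sequentially by blast
  qed
  then show ?thesis
    by (rule filterlim_compose[OF filterlim_real_sequentially])
qed

theorem theorem4p1:
  fixes M :: "int set \<Rightarrow> 'a::cstar_algebra set"
    and \<gamma> :: "int \<Rightarrow> 'a \<Rightarrow> 'a"
    and chi :: "'a \<Rightarrow> complex"
    and I :: "nat \<Rightarrow> int set"
    and w :: "'a \<Rightarrow> 'w::cstar_algebra"
    and \<phi> :: "'w \<Rightarrow> complex"
    and xs :: "'a list"
  assumes "quasi_local TYPE('i) M"
    and "translation_action M \<gamma>"
    and "product_invariant_state M \<gamma> chi"
    and "\<forall>n. I n \<in> fin_intervals"
    and "\<forall>n. I n \<subseteq> I (Suc n)"
    and "(\<Union>n. I n) = UNIV"
    and "weyl_quasifree M \<gamma> chi w \<phi>"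
    and "set xs \<subseteq> local_sa M"
  shows "(\<lambda>n. chi (prod_list (map (\<lambda>x. exp (ci * fluct \<gamma> chi (I n) x)) xs)))
           \<longlonglongrightarrow> \<phi> (prod_list (map w xs))"
proof -
  interpret lattice_state "TYPE('i)" M \<gamma> chi
    by (rule lattice_state.intro) (rule assms)+
  have "finite (I n)" for n
  proof -
    have "I n \<in> fin_intervals" using assms(4) by blast
    then show ?thesis by (auto simp: fin_intervals_def)
  qed
  then have card: "filterlim (\<lambda>n. real (card (I n))) at_top sequentially"
    using assms by (intro card_exhaustion_at_top) auto
  show ?thesis
    using assms(8)
  \<comment> \<open>Induction from the right end, since both recursions append the last factor; for
    the empty product both states take the value 1 at the unit.\<close>
  proof (induction xs rule: rev_induct)
    case Nil
    have "\<phi> 1 = 1" using weyl_state[OF assms(7)] by (simp add: is_state_def)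
    then show ?case by (simp add: chi_1)
  next
    case (snoc x xs)
    then have "(\<lambda>n. chi (prod_list (map (\<lambda>x. exp (ci * fluct \<gamma> chi (I n) x)) xs))) \<longlonglongrightarrow> \<phi> (prod_list (map w xs))"
      by simp
    then show ?case
      unfolding weyl_snoc[OF assms(7) snoc.prems]
      using assms(4) card snoc.prems by (intro fluct_limit_snoc) auto
  qed
qed

end
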